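(* Let $\{P_n\}_{n\in\mathbb N_0}$ be the sequence of monic orthogonal polynomials with respect to a matrix weight $W$ of size $N$. Then the sequence $\{P_n\}_{n\in\mathbb N_0}$ is reducible if and only if its commutant $$\{T\in\mathrm{Mat}_N(\mathbb C): TP_n(x)=P_n(x)T\ \text{for all } n\in\mathbb N_0\text{ and all } x\}$$ contains non-scalar matrices.
   Context: A matrix weight of size $N$ on an interval $(a,b)\subseteq\mathbb R$ (possibly unbounded) is an integrable function $W:(a,b)\to\mathrm{Mat}_N(\mathbb C)$ such that $W(x)$ is positive semidefinite for all $x\in(a,b)$, positive definite for almost every $x$, and with finite moments $\int_a^b x^nW(x)\,dx$ of all orders $n\ge0$. The monic orthogonal polynomials $\{P_n\}_{n\ge0}$ of $W$ are the unique polynomials $P_n\in\mathrm{Mat}_N(\mathbb C)[x]$ of degree $n$ with leading coefficient $I$ such that $\int_a^bP_n(x)W(x)P_m(x)^*dx=0$ for $n\neq m$. A sequence $\{Q_n\}_{n\ge0}$ in $\mathrm{Mat}_N(\mathbb C)[x]$ is reducible if there is a nonsingular constant matrix $M$ such that, for all $n$, $MQ_n(x)M^{-1}=\begin{pmatrix}\tilde Q_n^1(x)&0\\0&\tilde Q_n^2(x)\end{pmatrix}$ with square diagonal blocks of positive sizes independent of $n$. A matrix is scalar if it is of the form $cI$, $c\in\mathbb C$. *)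

theory Defs
  imports
    "HOL-Analysis.Analysis"
    "HOL-Computational_Algebra.Polynomial"
    "Jordan_Normal_Form.Matrix"
    "Jordan_Normal_Form.Schur_Decomposition"
begin

text \<open>The order on \<open>complex\<close> is the one of \<open>Complex_Order\<close>: \<open>0 \<le> z\<close> and \<open>0 < z\<close> include that
  \<open>z\<close> is real. The form \<open>(A *\<^sub>v v) \<bullet>c v\<close> is \<open>v\<^sup>* A v\<close>.\<close>

definition pos_semidef :: "complex mat \<Rightarrow> bool" where
  "pos_semidef A \<longleftrightarrow> square_mat A \<and> mat_adjoint A = A \<and>
     (\<forall>v \<in> carrier_vec (dim_row A). 0 \<le> (A *\<^sub>v v) \<bullet>c v)"

definition pos_def :: "complex mat \<Rightarrow> bool" where
  "pos_def A \<longleftrightarrow> square_mat A \<and> mat_adjoint A = A \<and>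
     (\<forall>v \<in> carrier_vec (dim_row A). v \<noteq> 0\<^sub>v (dim_row A) \<longrightarrow> 0 < (A *\<^sub>v v) \<bullet>c v)"

text \<open>Integrals of matrix functions are taken entrywise, with respect to Lebesgue measure on the
  open interval \<open>einterval a b\<close>, whose endpoints may be infinite.\<close>

definition mat_integrable :: "nat \<Rightarrow> ereal \<Rightarrow> ereal \<Rightarrow> (real \<Rightarrow> complex mat) \<Rightarrow> bool" where
  "mat_integrable N a b F \<longleftrightarrow>
     (\<forall>i<N. \<forall>j<N. set_integrable lebesgue (einterval a b) (\<lambda>x. F x $$ (i, j)))"

definition mat_integral :: "nat \<Rightarrow> ereal \<Rightarrow> ereal \<Rightarrow> (real \<Rightarrow> complex mat) \<Rightarrow> complex mat" where
  "mat_integral N a b F = mat N N (\<lambda>(i, j). LINT x:einterval a b|lebesgue. F x $$ (i, j))"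

definition matrix_weight :: "nat \<Rightarrow> ereal \<Rightarrow> ereal \<Rightarrow> (real \<Rightarrow> complex mat) \<Rightarrow> bool" where
  "matrix_weight N a b W \<longleftrightarrow>
     (\<forall>x \<in> einterval a b. W x \<in> carrier_mat N N) \<and>
     mat_integrable N a b W \<and>
     (\<forall>x \<in> einterval a b. pos_semidef (W x)) \<and>
     (AE x in lebesgue. x \<in> einterval a b \<longrightarrow> pos_def (W x)) \<and>
     (\<forall>n. mat_integrable N a b (\<lambda>x. of_real (x ^ n) \<cdot>\<^sub>m W x))"

text \<open>An element of \<open>Mat\<^sub>N(\<complex>)[x]\<close> is represented as an \<open>N \<times> N\<close> matrix of complex polynomials.
  (The type of polynomials with matrix coefficients is not available, since \<open>mat\<close> does not fix the
  dimension and so has no zero.)\<close>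

definition mat_poly_eval :: "complex poly mat \<Rightarrow> complex \<Rightarrow> complex mat" where
  "mat_poly_eval P x = map_mat (\<lambda>p. poly p x) P"

definition mat_poly_coeff :: "complex poly mat \<Rightarrow> nat \<Rightarrow> complex mat" where
  "mat_poly_coeff P k = map_mat (\<lambda>p. coeff p k) P"

definition monic_of_degree :: "nat \<Rightarrow> nat \<Rightarrow> complex poly mat \<Rightarrow> bool" where
  "monic_of_degree N n P \<longleftrightarrow> P \<in> carrier_mat N N \<and>
     mat_poly_coeff P n = 1\<^sub>m N \<and> (\<forall>k>n. mat_poly_coeff P k = 0\<^sub>m N N)"

definition monic_orthogonal_polynomials ::
    "nat \<Rightarrow> ereal \<Rightarrow> ereal \<Rightarrow> (real \<Rightarrow> complex mat) \<Rightarrow> (nat \<Rightarrow> complex poly mat) \<Rightarrow> bool" where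
  "monic_orthogonal_polynomials N a b W P \<longleftrightarrow>
     (\<forall>n. monic_of_degree N n (P n)) \<and>
     (\<forall>n m. n \<noteq> m \<longrightarrow>
        mat_integral N a b
          (\<lambda>x. mat_poly_eval (P n) (of_real x) * W x * mat_adjoint (mat_poly_eval (P m) (of_real x)))
        = 0\<^sub>m N N)"

definition reducible_seq :: "nat \<Rightarrow> (nat \<Rightarrow> complex poly mat) \<Rightarrow> bool" where
  "reducible_seq N Q \<longleftrightarrow>
     (\<exists>M M' N\<^sub>1 N\<^sub>2 Q\<^sub>1 Q\<^sub>2.
        M \<in> carrier_mat N N \<and> M' \<in> carrier_mat N N \<and> inverts_mat M M' \<and> inverts_mat M' M \<and>
        0 < N\<^sub>1 \<and> 0 < N\<^sub>2 \<and> N\<^sub>1 + N\<^sub>2 = N \<and>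
        (\<forall>n. Q\<^sub>1 n \<in> carrier_mat N\<^sub>1 N\<^sub>1 \<and> Q\<^sub>2 n \<in> carrier_mat N\<^sub>2 N\<^sub>2 \<and>
          (\<forall>x. M * mat_poly_eval (Q n) x * M' =
             four_block_mat (mat_poly_eval (Q\<^sub>1 n) x) (0\<^sub>m N\<^sub>1 N\<^sub>2)
                            (0\<^sub>m N\<^sub>2 N\<^sub>1) (mat_poly_eval (Q\<^sub>2 n) x))))"

definition commutant :: "nat \<Rightarrow> (nat \<Rightarrow> complex poly mat) \<Rightarrow> complex mat set" where
  "commutant N P =
     {T \<in> carrier_mat N N. \<forall>n x. T * mat_poly_eval (P n) x = mat_poly_eval (P n) x * T}"

definition scalar_mat :: "nat \<Rightarrow> complex mat \<Rightarrow> bool" where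
  "scalar_mat N T \<longleftrightarrow> (\<exists>c. T = c \<cdot>\<^sub>m 1\<^sub>m N)"

end

theory Submission
  imports Defs "Jordan_Normal_Form.Jordan_Normal_Form_Existence"
begin

text \<open>A commutant can be nontrivial without containing a nontrivial idempotent, so the point is that
  the commutant of \<open>P\<^sub>n\<close> is closed under the adjoint with respect to \<open>S = \<integral> W\<close>. If \<open>T\<close> commutes
  with all \<open>P\<^sub>n\<close> then the moments \<open>M\<^sub>k\<close> of \<open>W\<close> satisfy \<open>T M\<^sub>k = M\<^sub>k C\<close> with \<open>C = S\<^sup>-\<^sup>1 T S\<close>,
  hence \<open>U M\<^sub>k = M\<^sub>k T\<^sup>*\<close> for \<open>U = C\<^sup>*\<close>. Therefore \<open>U P\<^sub>n - P\<^sub>n U\<close> has degree less than \<open>n\<close> and is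
  orthogonal to all powers \<open>x\<^sup>m\<close> with \<open>m < n\<close>, so it vanishes. One of the \<open>S\<close>-selfadjoint matrices
  \<open>T + U\<close> and \<open>\<i> (T - U)\<close> is not scalar; it is diagonalizable, and grouping a basis of
  eigenvectors by one eigenvalue against the others block diagonalizes every \<open>P\<^sub>n\<close>.\<close>

section \<open>Entries of products and adjoints of complex matrices\<close>

lemma mat_mult_entry:
  assumes "A \<in> carrier_mat n m" "B \<in> carrier_mat m k" "i < n" "j < k"
  shows "(A * B) $$ (i, j) = (\<Sum>l<m. A $$ (i, l) * B $$ (l, j))"
  using assms by (auto simp: scalar_prod_def atLeast0LessThan)

lemma mat_adjoint_carrier [simp]:
  "A \<in> carrier_mat n m \<Longrightarrow> mat_adjoint A \<in> carrier_mat m n"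
  by (auto simp: mat_adjoint_def)

lemma mat_adjoint_dim [simp]:
  "dim_row (mat_adjoint A) = dim_col A" "dim_col (mat_adjoint A) = dim_row A"
  by (simp_all add: mat_adjoint_def)

lemma mat_adjoint_entry [simp]:
  fixes A :: "complex mat"
  assumes "i < dim_col A" "j < dim_row A"
  shows "mat_adjoint A $$ (i, j) = cnj (A $$ (j, i))"
  using assms by (auto simp: mat_adjoint_def mat_of_rows_def)

lemma mat_adjoint_mult:
  fixes A B :: "complex mat"
  assumes "A \<in> carrier_mat n m" "B \<in> carrier_mat m k"
  shows "mat_adjoint (A * B) = mat_adjoint B * mat_adjoint A"
proof (rule eq_matI)
  fix i j assume "i < dim_row (mat_adjoint B * mat_adjoint A)" "j < dim_col (mat_adjoint B * mat_adjoint A)"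
  then have ij: "i < k" "j < n"
    using assms mat_adjoint_carrier[OF assms(1)] mat_adjoint_carrier[OF assms(2)] by auto
  show "mat_adjoint (A * B) $$ (i, j) = (mat_adjoint B * mat_adjoint A) $$ (i, j)"
    using assms ij
    by (subst mat_mult_entry[where n = k and m = m and k = n])
       (auto simp: mat_mult_entry[OF assms] mult.commute simp del: index_mult_mat(1))
qed (use assms in auto)

lemma mat_adjoint_adjoint [simp]:
  fixes A :: "complex mat"
  shows "mat_adjoint (mat_adjoint A) = A"
  by (intro eq_matI) auto

lemma mat_adjoint_add:
  fixes A B :: "complex mat"
  assumes "A \<in> carrier_mat n m" "B \<in> carrier_mat n m"
  shows "mat_adjoint (A + B) = mat_adjoint A + mat_adjoint B"
  using assms by (intro eq_matI) auto

lemma mat_adjoint_smult: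
  fixes A :: "complex mat"
  assumes "A \<in> carrier_mat n m"
  shows "mat_adjoint (c \<cdot>\<^sub>m A) = cnj c \<cdot>\<^sub>m mat_adjoint A"
  using assms by (intro eq_matI) auto

lemma mat_adjoint_one [simp]: "mat_adjoint (1\<^sub>m n) = (1\<^sub>m n :: complex mat)"
  by (intro eq_matI) auto

lemma mat_eq_of_add_eq_zero:
  fixes A B C :: "'a :: ab_group_add mat"
  assumes "A \<in> carrier_mat n m" "B \<in> carrier_mat n m" "C \<in> carrier_mat n m"
    "A + B = 0\<^sub>m n m" "A + C = 0\<^sub>m n m"
  shows "B = C"
proof (rule eq_matI)
  fix i j assume "i < dim_row C" "j < dim_col C"
  then have ij: "i < n" "j < m" using assms by auto
  have "A $$ (i, j) + B $$ (i, j) = 0" "A $$ (i, j) + C $$ (i, j) = 0"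
    using arg_cong[OF assms(4), of "\<lambda>X. X $$ (i, j)"] arg_cong[OF assms(5), of "\<lambda>X. X $$ (i, j)"]
      assms(1-3) ij by simp_all
  then show "B $$ (i, j) = C $$ (i, j)" by (metis add_left_cancel)
qed (use assms in auto)

lemma mat_eq_of_diff_eq_zero:
  fixes A B :: "'a :: ab_group_add mat"
  assumes "A \<in> carrier_mat n m" "B \<in> carrier_mat n m" "A - B = 0\<^sub>m n m"
  shows "A = B"
proof (rule eq_matI)
  fix i j assume "i < dim_row B" "j < dim_col B"
  then show "A $$ (i, j) = B $$ (i, j)"
    using arg_cong[OF assms(3), of "\<lambda>X. X $$ (i, j)"] assms(1,2) by simp
qed (use assms in auto)

section \<open>Finite sums of square matrices\<close>

text \<open>The size is a parameter because the type \<open>mat\<close> does not fix it; it gives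
  the empty sum the value \<open>0\<^sub>m N N\<close>.\<close>

definition mat_sum :: "nat \<Rightarrow> (nat \<Rightarrow> complex mat) \<Rightarrow> nat set \<Rightarrow> complex mat" where
  "mat_sum N f A = mat N N (\<lambda>ij. \<Sum>k\<in>A. f k $$ ij)"

lemma mat_sum_carrier [simp]: "mat_sum N f A \<in> carrier_mat N N"
  by (simp add: mat_sum_def)

lemma mat_sum_dim [simp]: "dim_row (mat_sum N f A) = N" "dim_col (mat_sum N f A) = N"
  by (simp_all add: mat_sum_def)

lemma mat_sum_entry [simp]:
  "i < N \<Longrightarrow> j < N \<Longrightarrow> mat_sum N f A $$ (i, j) = (\<Sum>k\<in>A. f k $$ (i, j))"
  by (simp add: mat_sum_def)

lemma mat_sum_cong: "A = B \<Longrightarrow> (\<And>k. k \<in> B \<Longrightarrow> f k = g k) \<Longrightarrow> mat_sum N f A = mat_sum N g B"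
  by (auto simp: mat_sum_def intro!: eq_matI sum.cong)

lemma mat_sum_zero: "(\<And>k. k \<in> A \<Longrightarrow> f k = 0\<^sub>m N N) \<Longrightarrow> mat_sum N f A = 0\<^sub>m N N"
  by (auto simp: mat_sum_def intro!: eq_matI sum.neutral)

lemma mat_sum_lessThan_Suc:
  "f n \<in> carrier_mat N N \<Longrightarrow> mat_sum N f {..<Suc n} = mat_sum N f {..<n} + f n"
  by (auto intro!: eq_matI)

lemma mat_sum_diff:
  assumes "\<And>k. k \<in> A \<Longrightarrow> f k \<in> carrier_mat N N" "\<And>k. k \<in> A \<Longrightarrow> g k \<in> carrier_mat N N"
  shows "mat_sum N (\<lambda>k. f k - g k) A = mat_sum N f A - mat_sum N g A"
proof (rule eq_matI)
  fix i j assume "i < dim_row (mat_sum N f A - mat_sum N g A)" "j < dim_col (mat_sum N f A - mat_sum N g A)"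
  then have ij: "i < N" "j < N" by auto
  have "(f k - g k) $$ (i, j) = f k $$ (i, j) - g k $$ (i, j)" if "k \<in> A" for k
    using assms(1,2)[OF that] ij by auto
  then show "mat_sum N (\<lambda>k. f k - g k) A $$ (i, j) = (mat_sum N f A - mat_sum N g A) $$ (i, j)"
    using ij by (simp add: sum_subtractf)
qed auto

lemma mult_mat_sum:
  assumes "X \<in> carrier_mat N N" "\<And>k. k \<in> A \<Longrightarrow> f k \<in> carrier_mat N N"
  shows "X * mat_sum N f A = mat_sum N (\<lambda>k. X * f k) A"
proof (rule eq_matI)
  fix i j assume "i < dim_row (mat_sum N (\<lambda>k. X * f k) A)" "j < dim_col (mat_sum N (\<lambda>k. X * f k) A)"
  then have ij: "i < N" "j < N" by auto
  have "(X * mat_sum N f A) $$ (i, j) = (\<Sum>l<N. \<Sum>k\<in>A. X $$ (i, l) * f k $$ (l, j))"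
    using ij by (simp add: mat_mult_entry[OF assms(1) mat_sum_carrier] sum_distrib_left
        del: index_mult_mat(1))
  also have "\<dots> = (\<Sum>k\<in>A. \<Sum>l<N. X $$ (i, l) * f k $$ (l, j))"
    by (rule sum.swap)
  also have "\<dots> = (\<Sum>k\<in>A. (X * f k) $$ (i, j))"
    using ij by (intro sum.cong refl) (metis mat_mult_entry[OF assms(1) assms(2)])
  finally show "(X * mat_sum N f A) $$ (i, j) = mat_sum N (\<lambda>k. X * f k) A $$ (i, j)"
    using ij by simp
qed (use assms in auto)

lemma mat_sum_mult:
  assumes "X \<in> carrier_mat N N" "\<And>k. k \<in> A \<Longrightarrow> f k \<in> carrier_mat N N"
  shows "mat_sum N f A * X = mat_sum N (\<lambda>k. f k * X) A"
proof (rule eq_matI)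
  fix i j assume "i < dim_row (mat_sum N (\<lambda>k. f k * X) A)" "j < dim_col (mat_sum N (\<lambda>k. f k * X) A)"
  then have ij: "i < N" "j < N" by auto
  have "(mat_sum N f A * X) $$ (i, j) = (\<Sum>l<N. \<Sum>k\<in>A. f k $$ (i, l) * X $$ (l, j))"
    using ij by (simp add: mat_mult_entry[OF mat_sum_carrier assms(1)] sum_distrib_right
        del: index_mult_mat(1))
  also have "\<dots> = (\<Sum>k\<in>A. \<Sum>l<N. f k $$ (i, l) * X $$ (l, j))"
    by (rule sum.swap)
  also have "\<dots> = (\<Sum>k\<in>A. (f k * X) $$ (i, j))"
    using ij by (intro sum.cong refl) (metis mat_mult_entry[OF assms(2) assms(1)])
  finally show "(mat_sum N f A * X) $$ (i, j) = mat_sum N (\<lambda>k. f k * X) A $$ (i, j)"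
    using ij by simp
qed (use assms in auto)

section \<open>Anisotropic forms and diagonalization of matrices selfadjoint for them\<close>

text \<open>Equivalent to anisotropy of the form \<open>u \<mapsto> u S u\<^sup>*\<close> on row vectors; a square \<open>D\<close> collects
  \<open>N\<close> of them.\<close>

definition definite_mat :: "nat \<Rightarrow> complex mat \<Rightarrow> bool" where
  "definite_mat N S \<longleftrightarrow> S \<in> carrier_mat N N \<and>
     (\<forall>D \<in> carrier_mat N N. D * S * mat_adjoint D = 0\<^sub>m N N \<longrightarrow> D = 0\<^sub>m N N)"

text \<open>A nonzero left null vector \<open>v\<close> of \<open>S\<close>, repeated as every row
  of \<open>D\<close>, would give \<open>D * S = 0\<^sub>m N N\<close> with \<open>D\<close>
  nonzero, against anisotropy.\<close>

lemma definite_mat_invertible: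
  assumes "definite_mat N S"
  obtains R where "R \<in> carrier_mat N N" "S * R = 1\<^sub>m N" "R * S = 1\<^sub>m N"
proof -
  have S: "S \<in> carrier_mat N N" using assms by (simp add: definite_mat_def)
  have "det S \<noteq> 0"
  proof
    assume "det S = 0"
    then have "det (transpose_mat S) = 0" using det_transpose[OF S] by simp
    then obtain v where v: "v \<in> carrier_vec N" "v \<noteq> 0\<^sub>v N" "transpose_mat S *\<^sub>v v = 0\<^sub>v N"
      using det_0_iff_vec_prod_zero_field[of "transpose_mat S" N] S by auto
    define D where "D = mat N N (\<lambda>(i, j). v $ j)"
    have D: "D \<in> carrier_mat N N" by (simp add: D_def)
    have "D * S = 0\<^sub>m N N"
    proof (rule eq_matI)
      fix i j assume "i < dim_row (0\<^sub>m N N :: complex mat)" "j < dim_col (0\<^sub>m N N :: complex mat)"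
      then have ij: "i < N" "j < N" by auto
      have "(D * S) $$ (i, j) = (\<Sum>l<N. S $$ (l, j) * v $ l)"
        using ij by (subst mat_mult_entry[OF D S]) (simp_all add: D_def mult.commute)
      also have "\<dots> = (transpose_mat S *\<^sub>v v) $ j"
        using S v(1) ij by (auto simp: scalar_prod_def atLeast0LessThan)
      finally show "(D * S) $$ (i, j) = 0\<^sub>m N N $$ (i, j)" using v(3) ij by simp
    qed (use S D in auto)
    then have "D * S * mat_adjoint D = 0\<^sub>m N N"
      using left_mult_zero_mat[OF mat_adjoint_carrier[OF D]] by simp
    then have "D = 0\<^sub>m N N" using assms D by (simp add: definite_mat_def)
    then have "v $ j = 0" if "j < N" for j
      using that by (metis D_def case_prod_conv index_mat(1) index_zero_mat(1))
    then show False using v(1,2) by (metis carrier_vecD eq_vecI index_zero_vec)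
  qed
  then obtain R where "R \<in> carrier_mat N N" "S * R = 1\<^sub>m N" "R * S = 1\<^sub>m N"
    using det_non_zero_imp_unit[OF S] S by (auto simp: Units_def ring_mat_def)
  then show ?thesis using that by blast
qed

text \<open>The entry is the form evaluated at row \<open>k\<close> of \<open>Q\<close>, which is
  nonzero because \<open>Q\<close> has a right inverse. To apply \<open>definite_mat\<close>, that
  row is repeated in all rows of \<open>D\<close>, so that every entry of
  \<open>D * S * mat_adjoint D\<close> is this one number.\<close>

lemma congruent_definite_diagonal_nonzero:
  assumes S: "definite_mat N S" and Q: "Q \<in> carrier_mat N N" "R \<in> carrier_mat N N" "Q * R = 1\<^sub>m N"
    and k: "k < N"
  shows "(Q * S * mat_adjoint Q) $$ (k, k) \<noteq> 0"
proof
  assume 0: "(Q * S * mat_adjoint Q) $$ (k, k) = 0"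
  have Sc: "S \<in> carrier_mat N N" using S by (simp add: definite_mat_def)
  note aQ = mat_adjoint_carrier[OF Q(1)]
  define D where "D = mat N N (\<lambda>(i, j). Q $$ (k, j))"
  have D: "D \<in> carrier_mat N N" by (simp add: D_def)
  note aD = mat_adjoint_carrier[OF D]
  have DS: "D * S \<in> carrier_mat N N" "Q * S \<in> carrier_mat N N" using D Sc Q by auto
  have "D * S * mat_adjoint D = 0\<^sub>m N N"
  proof (rule eq_matI)
    fix i j assume "i < dim_row (0\<^sub>m N N :: complex mat)" "j < dim_col (0\<^sub>m N N :: complex mat)"
    then have ij: "i < N" "j < N" by auto
    have "(D * S * mat_adjoint D) $$ (i, j) = (Q * S * mat_adjoint Q) $$ (k, k)"
      using ij k Q(1) D
      by (simp add: mat_mult_entry[OF DS(1) aD] mat_mult_entry[OF DS(2) aQ]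
          mat_mult_entry[OF D Sc] mat_mult_entry[OF Q(1) Sc] del: index_mult_mat(1))
         (simp add: D_def)
    then show "(D * S * mat_adjoint D) $$ (i, j) = 0\<^sub>m N N $$ (i, j)" using 0 ij by simp
  qed (use D DS aD in auto)
  then have "D = 0\<^sub>m N N" using S D by (simp add: definite_mat_def)
  then have "Q $$ (k, j) = 0" if "j < N" for j
    using that k by (metis D_def case_prod_conv index_mat(1) index_zero_mat(1))
  then have "(Q * R) $$ (k, k) = 0" using mat_mult_entry[OF Q(1,2) k k] by simp
  then show False using Q(3) k by simp
qed

text \<open>A nonzero superdiagonal entry lies inside a single Jordan block, and the diagonal of a
  block is constant.\<close>

lemma jordan_matrix_bidiagonal:
  assumes "i < sum_list (map fst n_as)" "j < sum_list (map fst n_as)"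
  shows "j \<noteq> i \<Longrightarrow> j \<noteq> Suc i \<Longrightarrow> jordan_matrix n_as $$ (i, j) = 0"
    and "j = Suc i \<Longrightarrow> jordan_matrix n_as $$ (i, j) \<noteq> (0 :: complex) \<Longrightarrow>
         jordan_matrix n_as $$ (i, i) = jordan_matrix n_as $$ (j, j)"
proof -
  have "(j \<noteq> i \<longrightarrow> j \<noteq> Suc i \<longrightarrow> jordan_matrix n_as $$ (i, j) = 0) \<and>
    (j = Suc i \<longrightarrow> jordan_matrix n_as $$ (i, j) \<noteq> (0 :: complex) \<longrightarrow>
         jordan_matrix n_as $$ (i, i) = jordan_matrix n_as $$ (j, j))"
    using assms
  proof (induction n_as arbitrary: i j)
    case (Cons a n_as)
    obtain n c where a: "a = (n, c)" by force
    have J: "jordan_matrix (a # n_as) = four_block_mat (jordan_block n c)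
        (0\<^sub>m n (sum_list (map fst n_as))) (0\<^sub>m (sum_list (map fst n_as)) n) (jordan_matrix n_as)"
      using jordan_matrix_dim[of n_as] by (simp add: a jordan_matrix_def Let_def)
    define s where "s = sum_list (map fst n_as)"
    have E: "jordan_matrix (a # n_as) $$ (i, j) =
        (if i < n then if j < n then jordan_block n c $$ (i, j) else 0
         else if j < n then 0 else jordan_matrix n_as $$ (i - n, j - n))"
      if "i < n + s" "j < n + s" for i j
      using that unfolding J s_def by simp
    have ij: "i < n + s" "j < n + s" using Cons.prems by (simp_all add: a s_def)
    show ?case
    proof (cases "i < n")
      case True
      then show ?thesis using ij by (simp add: E)
    next
      case i: False
      show ?thesis
      proof (cases "j < n")
        case True
        then show ?thesis using ij i by (simp add: E)
      next
        case False
        then show ?thesis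
          using ij i Cons.IH[of "i - n" "j - n"] by (auto simp: E s_def Suc_diff_le)
      qed
    qed
  qed simp
  then show "j \<noteq> i \<Longrightarrow> j \<noteq> Suc i \<Longrightarrow> jordan_matrix n_as $$ (i, j) = 0"
    and "j = Suc i \<Longrightarrow> jordan_matrix n_as $$ (i, j) \<noteq> (0 :: complex) \<Longrightarrow>
         jordan_matrix n_as $$ (i, i) = jordan_matrix n_as $$ (j, j)" by auto
qed

text \<open>The Jordan form replaces the usual induction over orthogonal complements. If
  \<open>G\<close> is the Gram matrix of the rows of \<open>Q\<close> under the form
  \<open>S\<close>, selfadjointness of \<open>H\<close> becomes
  \<open>J * G = G * mat_adjoint J\<close>. By anisotropy \<open>G\<close> has no zero on its
  diagonal, and this rules out Jordan blocks of size greater than one.\<close>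

lemma selfadjoint_diagonalizable:
  assumes S: "definite_mat N S" and H: "H \<in> carrier_mat N N"
    and self: "H * S = S * mat_adjoint H"
  obtains Q R J where "Q \<in> carrier_mat N N" "R \<in> carrier_mat N N" "J \<in> carrier_mat N N"
    "Q * R = 1\<^sub>m N" "R * Q = 1\<^sub>m N" "Q * H = J * Q"
    "\<And>i j. i < N \<Longrightarrow> j < N \<Longrightarrow> i \<noteq> j \<Longrightarrow> J $$ (i, j) = 0"
proof -
  have Sc: "S \<in> carrier_mat N N" using S by (simp add: definite_mat_def)
  obtain as where "char_poly H = (\<Prod>a\<leftarrow>as. [:- a, 1:])" using char_poly_factorized[OF H] by blast
  then obtain n_as where "jordan_nf H n_as" using jordan_nf_exists[OF H] by blast
  then obtain R Q where w: "similar_mat_wit H (jordan_matrix n_as) R Q"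
    by (auto simp: jordan_nf_def similar_mat_def)
  define J where "J = jordan_matrix n_as"
  have car: "Q \<in> carrier_mat N N" "R \<in> carrier_mat N N" "J \<in> carrier_mat N N"
    and inv: "Q * R = 1\<^sub>m N" "R * Q = 1\<^sub>m N" and HJ: "H = R * J * Q"
    using w H unfolding similar_mat_wit_def J_def Let_def by auto
  have N: "N = sum_list (map fst n_as)" using car(3) unfolding J_def by auto
  note aQ = mat_adjoint_carrier[OF car(1)] and aH = mat_adjoint_carrier[OF H]
    and aJ = mat_adjoint_carrier[OF car(3)]
  have QH: "Q * H = J * Q"
  proof -
    have "Q * H = (Q * R) * (J * Q)" unfolding HJ using car by (simp add: assoc_mult_mat[of _ N N _ N _ N])
    then show ?thesis using inv car by simp
  qed
  define G where "G = Q * S * mat_adjoint Q"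
  have G: "G \<in> carrier_mat N N" using car Sc aQ by (auto simp: G_def)
  have JG: "J * G = G * mat_adjoint J"
  proof -
    have "J * G = (J * Q) * (S * mat_adjoint Q)"
      unfolding G_def using car Sc aQ by (simp add: assoc_mult_mat[of _ N N _ N _ N])
    also have "\<dots> = Q * (H * S) * mat_adjoint Q"
      unfolding QH[symmetric] using car H Sc aQ by (simp add: assoc_mult_mat[of _ N N _ N _ N])
    also have "\<dots> = Q * S * (mat_adjoint H * mat_adjoint Q)"
      unfolding self using car aH Sc aQ by (simp add: assoc_mult_mat[of _ N N _ N _ N])
    also have "mat_adjoint H * mat_adjoint Q = mat_adjoint Q * mat_adjoint J"
      using QH mat_adjoint_mult[OF car(1) H] mat_adjoint_mult[OF car(3) car(1)] by simp
    finally show ?thesis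
      unfolding G_def using car aJ Sc aQ by (simp add: assoc_mult_mat[of _ N N _ N _ N])
  qed
  have Gkk: "G $$ (k, k) \<noteq> 0" if "k < N" for k
    unfolding G_def by (rule congruent_definite_diagonal_nonzero[OF S car(1,2) inv(1) that])
  have J0: "J $$ (i, j) = 0" if "i < N" "j < N" "j \<noteq> i" "j \<noteq> Suc i" for i j
    using jordan_matrix_bidiagonal(1)[of i n_as j] that N J_def by simp
  \<comment> \<open>The superdiagonal of \<open>J\<close>, extended by 0 in the last row: there the
    out-of-range values \<open>f (Suc i)\<close> and \<open>G $$ (Suc i, k)\<close> in the
    identities below get coefficient 0.\<close>
  define c where "c i = (if Suc i < N then J $$ (i, Suc i) else 0)" for i
  have row: "(\<Sum>l<N. J $$ (i, l) * f l) = J $$ (i, i) * f i + c i * f (Suc i)"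
    if "i < N" for i and f :: "nat \<Rightarrow> complex"
  proof -
    have "(\<Sum>l<N. J $$ (i, l) * f l) = (\<Sum>l\<in>{i, Suc i} \<inter> {..<N}. J $$ (i, l) * f l)"
      using that J0 by (intro sum.mono_neutral_right) auto
    also have "\<dots> = J $$ (i, i) * f i + c i * f (Suc i)"
      using that by (cases "Suc i < N") (auto simp: c_def Int_insert_left)
    finally show ?thesis .
  qed
  have JG_entry: "J $$ (i, i) * G $$ (i, k) + c i * G $$ (Suc i, k)
      = cnj (J $$ (k, k)) * G $$ (i, k) + cnj (c k) * G $$ (i, Suc k)" if "i < N" "k < N" for i k
  proof -
    have "J $$ (i, i) * G $$ (i, k) + c i * G $$ (Suc i, k) = (J * G) $$ (i, k)"
      unfolding mat_mult_entry[OF car(3) G that] by (rule row[OF that(1), symmetric])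
    also have "\<dots> = (\<Sum>l<N. G $$ (i, l) * cnj (J $$ (k, l)))"
      unfolding JG mat_mult_entry[OF G aJ that] using car(3) that by (intro sum.cong) auto
    also have "\<dots> = cnj (\<Sum>l<N. J $$ (k, l) * cnj (G $$ (i, l)))"
      by (simp add: mult.commute)
    also have "\<dots> = cnj (J $$ (k, k)) * G $$ (i, k) + cnj (c k) * G $$ (i, Suc k)"
      unfolding row[OF that(2)] by simp
    finally show ?thesis .
  qed
  \<comment> \<open>At the last nonzero superdiagonal entry, the two basis vectors involved share a real
    eigenvalue, and comparing entries of \<open>J G = G J\<^sup>*\<close> forces the entry to vanish.\<close>
  have c0: "c i = 0" for i
  proof (rule ccontr)
    assume "c i \<noteq> 0"
    define A where "A = {i. c i \<noteq> 0}"
    have "A \<subseteq> {..<N}" by (auto simp: A_def c_def split: if_splits)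
    then have fin: "finite A" by (rule finite_subset) simp
    define m where "m = Max A"
    have "m \<in> A" using \<open>c i \<noteq> 0\<close> fin unfolding m_def by (intro Max_in) (auto simp: A_def)
    then have cm: "c m \<noteq> 0" and m: "Suc m < N" by (auto simp: A_def c_def split: if_splits)
    have cSm: "c (Suc m) = 0"
      using Max_ge[OF fin, of "Suc m"] unfolding m_def[symmetric] by (auto simp: A_def)
    have eq: "J $$ (m, m) = J $$ (Suc m, Suc m)"
      using jordan_matrix_bidiagonal(2)[of m n_as "Suc m"] cm m N by (simp add: J_def c_def)
    have "J $$ (Suc m, Suc m) = cnj (J $$ (Suc m, Suc m))"
      using JG_entry[OF m m] cSm Gkk[OF m] by simp
    then have "c m * G $$ (Suc m, Suc m) = 0"
      using JG_entry[of m "Suc m"] m cSm eq by simp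
    then show False using cm Gkk[OF m] by simp
  qed
  have "J $$ (i, j) = 0" if "i < N" "j < N" "i \<noteq> j" for i j
    using J0[of i j] c0[of i] that by (cases "j = Suc i") (auto simp: c_def)
  with car inv QH show ?thesis using that by blast
qed

section \<open>Algebra of the moments and of the coefficients of the orthogonal polynomials\<close>

text \<open>The orthogonality problem with the integral removed: \<open>M k\<close> stands for the
  moment of order \<open>k\<close> and \<open>p n k\<close> for the coefficient of x^k in P_n. The
  double sums are the matrix inner product of two polynomials expanded in moments, and
  \<open>definite\<close> says that this product is anisotropic on polynomials of degree less than
  \<open>n\<close>.\<close>

locale monic_hankel_orthogonal =
  fixes N :: nat and M :: "nat \<Rightarrow> complex mat" and p :: "nat \<Rightarrow> nat \<Rightarrow> complex mat"
  assumes M_carrier [simp]: "M k \<in> carrier_mat N N"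
    and M_selfadjoint: "mat_adjoint (M k) = M k"
    and definite: "\<lbrakk>\<And>k. D k \<in> carrier_mat N N;
      mat_sum N (\<lambda>j. mat_sum N (\<lambda>k. D k * M (k + j)) {..<n} * mat_adjoint (D j)) {..<n} = 0\<^sub>m N N;
      l < n\<rbrakk> \<Longrightarrow> D l = 0\<^sub>m N N"
    and p_carrier [simp]: "p n k \<in> carrier_mat N N"
    and p_monic: "p n n = 1\<^sub>m N"
    and p_degree: "n < k \<Longrightarrow> p n k = 0\<^sub>m N N"
    and p_orthogonal: "n \<noteq> m \<Longrightarrow>
      mat_sum N (\<lambda>j. mat_sum N (\<lambda>k. p n k * M (k + j)) {..<Suc n} * mat_adjoint (p m j)) {..<Suc m}
        = 0\<^sub>m N N"
begin

lemma M_dim [simp]: "dim_row (M k) = N" "dim_col (M k) = N"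
  using M_carrier[of k] by blast+

text \<open>Strong induction on \<open>m\<close>: in the product of P_n with P_m the powers below
  x^m contribute nothing by induction, and the leading coefficient of P_m is the identity, so the
  product with x^m itself remains.\<close>

lemma orthogonal_power:
  assumes "m < n"
  shows "mat_sum N (\<lambda>k. p n k * M (k + m)) {..<Suc n} = 0\<^sub>m N N"
  using assms
proof (induction m rule: less_induct)
  case (less m)
  define V where "V j = mat_sum N (\<lambda>k. p n k * M (k + j)) {..<Suc n}" for j
  have V: "V j \<in> carrier_mat N N" for j by (simp add: V_def)
  have ap: "mat_adjoint (p m j) \<in> carrier_mat N N" for j by simp
  have "0\<^sub>m N N = mat_sum N (\<lambda>j. V j * mat_adjoint (p m j)) {..<Suc m}"
    using p_orthogonal[of n m] less.prems by (simp add: V_def)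
  also have "\<dots> = mat_sum N (\<lambda>j. V j * mat_adjoint (p m j)) {..<m} + V m * mat_adjoint (p m m)"
    by (rule mat_sum_lessThan_Suc) (use V ap in \<open>blast intro: mult_carrier_mat\<close>)
  also have "mat_sum N (\<lambda>j. V j * mat_adjoint (p m j)) {..<m} = 0\<^sub>m N N"
    using less.IH less.prems
    by (intro mat_sum_zero) (simp add: V_def left_mult_zero_mat[OF ap])
  also have "V m * mat_adjoint (p m m) = V m" using right_mult_one_mat[OF V] by (simp add: p_monic)
  finally show ?case using V by (simp add: V_def)
qed

text \<open>The case \<open>n = 1\<close> of \<open>definite\<close>, that is, the product
  restricted to constant polynomials.\<close>

lemma definite_M0: "definite_mat N (M 0)"
  unfolding definite_mat_def
proof (intro conjI ballI impI)
  fix D assume D: "D \<in> carrier_mat N N" "D * M 0 * mat_adjoint D = 0\<^sub>m N N"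
  have "mat_sum N (\<lambda>j. mat_sum N (\<lambda>k. D * M (k + j)) {..<1} * mat_adjoint D) {..<1} = 0\<^sub>m N N"
  proof -
    have "mat_sum N (\<lambda>k. D * M k) {..<1} = D * M 0"
      using D(1) by (intro eq_matI) auto
    then show ?thesis using D by (intro eq_matI) (auto simp del: index_mult_mat(1))
  qed
  then show "D = 0\<^sub>m N N" using definite[of "\<lambda>_. D" 1 0] D(1) by simp
qed simp

text \<open>Both functionals \<open>F \<mapsto> \<integral> F T W\<close> and \<open>F \<mapsto> \<integral> F W C\<close> vanish on all \<open>P\<^sub>n\<close> with
  \<open>n \<ge> 1\<close>, and \<open>C\<close> is chosen so that they agree on constants.\<close>

lemma commuting_moments:
  assumes T: "T \<in> carrier_mat N N" "\<And>n k. T * p n k = p n k * T"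
    and C: "C \<in> carrier_mat N N" "T * M 0 = M 0 * C"
  shows "T * M k = M k * C"
proof (induction k rule: less_induct)
  case (less k)
  show ?case
  proof (cases "k = 0")
    case False
    have car: "p k l * M l \<in> carrier_mat N N" for l by (rule mult_carrier_mat[where n = N]) auto
    \<comment> \<open>Orthogonality of P_k to constants, together with
      \<open>p k k = 1\<^sub>m N\<close>, gives \<open>M k\<close> as the negative of
      \<open>L\<close>, which involves lower moments only. So it suffices to move \<open>T\<close>
      through \<open>L\<close>.\<close>
    define L where "L = mat_sum N (\<lambda>l. p k l * M l) {..<k}"
    have L: "L \<in> carrier_mat N N" by (simp add: L_def)
    have "0\<^sub>m N N = mat_sum N (\<lambda>l. p k l * M l) {..<Suc k}"
      using orthogonal_power[of 0 k] False by simp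
    also have "\<dots> = L + M k"
      unfolding L_def using mat_sum_lessThan_Suc[of "\<lambda>l. p k l * M l", OF car]
      by (simp add: p_monic left_mult_one_mat[OF M_carrier])
    finally have LM: "L + M k = 0\<^sub>m N N" by simp
    have "T * L = mat_sum N (\<lambda>l. T * (p k l * M l)) {..<k}"
      unfolding L_def by (rule mult_mat_sum[OF T(1) car])
    also have "\<dots> = mat_sum N (\<lambda>l. (p k l * M l) * C) {..<k}"
    proof (rule mat_sum_cong[OF refl])
      fix l assume l: "l \<in> {..<k}"
      have "T * (p k l * M l) = (T * p k l) * M l" using T(1) by (simp add: assoc_mult_mat[of _ N N _ N _ N])
      also have "\<dots> = p k l * (T * M l)" unfolding T(2) using T(1) by (simp add: assoc_mult_mat[of _ N N _ N _ N])
      also have "\<dots> = (p k l * M l) * C" using less.IH[of l] l C(1) by (simp add: assoc_mult_mat[of _ N N _ N _ N])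
      finally show "T * (p k l * M l) = (p k l * M l) * C" .
    qed
    also have "\<dots> = L * C" unfolding L_def by (rule mat_sum_mult[OF C(1) car, symmetric])
    finally have TL: "T * L = L * C" .
    have "T * L + T * M k = T * (L + M k)" "L * C + M k * C = (L + M k) * C"
      using mult_add_distrib_mat[OF T(1) L M_carrier] add_mult_distrib_mat[OF L M_carrier C(1)] by simp_all
    then have sums: "T * L + T * M k = 0\<^sub>m N N" "L * C + M k * C = 0\<^sub>m N N"
      unfolding LM using T(1) C(1) by simp_all
    have cars: "L * C \<in> carrier_mat N N" "T * M k \<in> carrier_mat N N" "M k * C \<in> carrier_mat N N"
      using T(1) C(1) L by (auto intro: mult_carrier_mat[where n = N])
    show ?thesis by (rule mat_eq_of_add_eq_zero[OF cars sums[unfolded TL]])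
  qed (use C in simp)
qed

text \<open>The leading terms of T P_n and P_n T cancel, so \<open>D\<close> lists the coefficients
  of a polynomial of degree less than \<open>n\<close>. Its product with x^m for
  \<open>m < n\<close> is T times a zero product minus a zero product times \<open>C\<close>,
  because \<open>TM\<close> moves \<open>T\<close> past each moment. Anisotropy then kills
  \<open>D\<close>.\<close>

lemma commuting_coefficients:
  assumes T: "T \<in> carrier_mat N N" and C: "C \<in> carrier_mat N N"
    and TM: "\<And>k. T * M k = M k * C"
  shows "T * p n k = p n k * T"
proof -
  define D where "D k = T * p n k - p n k * T" for k
  have Tp: "T * p n k \<in> carrier_mat N N" "p n k * T \<in> carrier_mat N N" for k
    using T by (auto intro: mult_carrier_mat[where n = N])
  have D: "D k \<in> carrier_mat N N" for k using minus_carrier_mat[OF Tp(2)] by (simp add: D_def)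
  have D0: "D k = 0\<^sub>m N N" if "n \<le> k" for k
    using that T p_monic[of n] p_degree[of n k] by (cases "k = n") (auto simp: D_def)
  have DM: "D k * M m \<in> carrier_mat N N" for k m using D[of k] by (auto intro: mult_carrier_mat[where n = N])
  have row: "mat_sum N (\<lambda>k. D k * M (k + m)) {..<n} = 0\<^sub>m N N" if "m < n" for m
  proof -
    have car: "p n k * M (k + m) \<in> carrier_mat N N" for k by (rule mult_carrier_mat[where n = N]) auto
    have car2: "T * (p n k * M (k + m)) \<in> carrier_mat N N" "p n k * M (k + m) * C \<in> carrier_mat N N" for k
      using car[of k] T C by (auto intro: mult_carrier_mat[where n = N])
    \<comment> \<open>Since \<open>D n\<close> is zero, the index \<open>n\<close> may be added; the
      sum then runs over all coefficients of P_n, as \<open>orthogonal_power\<close>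
      requires.\<close>
    have "mat_sum N (\<lambda>k. D k * M (k + m)) {..<n} = mat_sum N (\<lambda>k. D k * M (k + m)) {..<Suc n}"
      using mat_sum_lessThan_Suc[of "\<lambda>k. D k * M (k + m)", OF DM]
      by (simp add: D0 left_mult_zero_mat[OF M_carrier])
    also have "\<dots> = mat_sum N (\<lambda>k. T * (p n k * M (k + m)) - p n k * M (k + m) * C) {..<Suc n}"
    proof (rule mat_sum_cong[OF refl])
      fix k
      have "D k * M (k + m) = T * p n k * M (k + m) - p n k * T * M (k + m)"
        unfolding D_def by (rule minus_mult_distrib_mat[OF Tp M_carrier])
      also have "p n k * T * M (k + m) = p n k * (T * M (k + m))"
        using T by (simp add: assoc_mult_mat[of _ N N _ N _ N])
      also have "\<dots> = p n k * M (k + m) * C"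
        unfolding TM using C by (simp add: assoc_mult_mat[of _ N N _ N _ N])
      also have "T * p n k * M (k + m) = T * (p n k * M (k + m))"
        using T by (simp add: assoc_mult_mat[of _ N N _ N _ N])
      finally show "D k * M (k + m) = T * (p n k * M (k + m)) - p n k * M (k + m) * C" .
    qed
    also have "\<dots> = T * mat_sum N (\<lambda>k. p n k * M (k + m)) {..<Suc n}
        - mat_sum N (\<lambda>k. p n k * M (k + m)) {..<Suc n} * C"
      unfolding mult_mat_sum[OF T car] mat_sum_mult[OF C car] by (rule mat_sum_diff[OF car2])
    also have "\<dots> = 0\<^sub>m N N" using orthogonal_power[OF that] T C by simp
    finally show ?thesis .
  qed
  have "mat_sum N (\<lambda>j. mat_sum N (\<lambda>k. D k * M (k + j)) {..<n} * mat_adjoint (D j)) {..<n} = 0\<^sub>m N N"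
    using row by (intro mat_sum_zero) (simp add: left_mult_zero_mat[OF mat_adjoint_carrier[OF D]])
  then have "D k = 0\<^sub>m N N" using definite[of D n k] D D0[of k] by (cases "k < n") auto
  then show ?thesis unfolding D_def by (rule mat_eq_of_diff_eq_zero[OF Tp])
qed

text \<open>\<open>U\<close> is the adjoint of \<open>T\<close> for the form \<open>M 0\<close>.
  Taking adjoints in \<open>T * M k = M k * C\<close> gives
  \<open>U * M k = M k * mat_adjoint T\<close>, since the moments are selfadjoint; this is the
  hypothesis of \<open>commuting_coefficients\<close> with \<open>U\<close> and
  \<open>mat_adjoint T\<close> in the roles of \<open>T\<close> and \<open>C\<close>.\<close>

lemma commuting_adjoint:
  assumes T: "T \<in> carrier_mat N N" "\<And>n k. T * p n k = p n k * T"
  obtains U where "U \<in> carrier_mat N N" "\<And>n k. U * p n k = p n k * U"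
    "U * M 0 = M 0 * mat_adjoint T" "T * M 0 = M 0 * mat_adjoint U"
proof -
  obtain R where R: "R \<in> carrier_mat N N" "M 0 * R = 1\<^sub>m N" "R * M 0 = 1\<^sub>m N"
    using definite_mat_invertible[OF definite_M0] by blast
  define C where "C = R * (T * M 0)"
  have TM: "T * M 0 \<in> carrier_mat N N" using T(1) by (auto intro: mult_carrier_mat[where n = N])
  have C: "C \<in> carrier_mat N N" using R(1) TM by (auto simp: C_def)
  have "M 0 * C = (M 0 * R) * (T * M 0)"
    unfolding C_def by (rule assoc_mult_mat[OF M_carrier R(1) TM, symmetric])
  then have C0: "T * M 0 = M 0 * C" using R(2) left_mult_one_mat[OF TM] by simp
  have TMk: "T * M k = M k * C" for k by (rule commuting_moments[OF T C C0])
  define U where "U = mat_adjoint C"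
  have U: "U \<in> carrier_mat N N" using C by (simp add: U_def)
  have aT: "mat_adjoint T \<in> carrier_mat N N" using T(1) by simp
  have UM: "U * M k = M k * mat_adjoint T" for k
    using arg_cong[OF TMk[of k], of mat_adjoint]
    by (simp add: mat_adjoint_mult[OF T(1) M_carrier] mat_adjoint_mult[OF M_carrier C] M_selfadjoint U_def)
  show ?thesis
  proof (rule that[OF U])
    show "U * p n k = p n k * U" for n k by (rule commuting_coefficients[OF U aT UM])
    show "U * M 0 = M 0 * mat_adjoint T" by (rule UM)
    show "T * M 0 = M 0 * mat_adjoint U" using C0 by (simp add: U_def)
  qed
qed

end

section \<open>Moments of a matrix weight and definiteness of its inner product\<close>

text \<open>Positivity of \<open>A\<close> is stated for column vectors, while polynomial
  coefficients act on the weight from the left, hence as rows. Conjugating the entries passes from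
  one convention to the other.\<close>

lemma quadratic_form_vec:
  fixes A :: "complex mat" and r :: "nat \<Rightarrow> complex"
  assumes "A \<in> carrier_mat N N"
  shows "(A *\<^sub>v vec N (\<lambda>p. cnj (r p))) \<bullet>c vec N (\<lambda>p. cnj (r p))
    = (\<Sum>q<N. (\<Sum>p<N. r p * A $$ (p, q)) * cnj (r q))"
proof -
  have "(A *\<^sub>v vec N (\<lambda>p. cnj (r p))) \<bullet>c vec N (\<lambda>p. cnj (r p))
    = (\<Sum>p<N. (\<Sum>q<N. A $$ (p, q) * cnj (r q)) * r p)"
    using assms by (simp add: scalar_prod_def atLeast0LessThan)
  also have "\<dots> = (\<Sum>p<N. \<Sum>q<N. r p * A $$ (p, q) * cnj (r q))"
    by (simp add: sum_distrib_right sum_distrib_left mult_ac)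
  also have "\<dots> = (\<Sum>q<N. \<Sum>p<N. r p * A $$ (p, q) * cnj (r q))" by (rule sum.swap)
  finally show ?thesis by (simp add: sum_distrib_right)
qed

definition moment :: "nat \<Rightarrow> ereal \<Rightarrow> ereal \<Rightarrow> (real \<Rightarrow> complex mat) \<Rightarrow> nat \<Rightarrow> complex mat" where
  "moment N a b W k = mat_integral N a b (\<lambda>x. of_real (x ^ k) \<cdot>\<^sub>m W x)"

lemma moment_carrier [simp]: "moment N a b W k \<in> carrier_mat N N"
  by (simp add: moment_def mat_integral_def)

lemma einterval_sets_lebesgue [simp]: "einterval a b \<in> sets lebesgue"
  by (rule sets_completionI_sets) simp

locale positive_matrix_weight =
  fixes N :: nat and a b :: ereal and W :: "real \<Rightarrow> complex mat"
  assumes weight: "matrix_weight N a b W" and nonempty: "a < b"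
begin

abbreviation "I \<equiv> einterval a b"

lemma W_carrier: "x \<in> I \<Longrightarrow> W x \<in> carrier_mat N N"
  using weight by (simp add: matrix_weight_def)

lemma moment_has_integral:
  assumes "p < N" "q < N"
  shows "has_bochner_integral lebesgue (\<lambda>x. indicator I x *\<^sub>R (of_real x ^ k * W x $$ (p, q)))
    (moment N a b W k $$ (p, q))"
proof -
  \<comment> \<open>Outside the interval nothing is known about the size of \<open>W x\<close>, so
    the two entries need not agree there; the indicator removes those points.\<close>
  have eq: "(\<lambda>x. indicator I x *\<^sub>R ((of_real (x ^ k) \<cdot>\<^sub>m W x) $$ (p, q)))
      = (\<lambda>x. indicator I x *\<^sub>R (of_real x ^ k * W x $$ (p, q)))"
  proof
    fix x show "indicator I x *\<^sub>R ((of_real (x ^ k) \<cdot>\<^sub>m W x) $$ (p, q))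
        = indicator I x *\<^sub>R (of_real x ^ k * W x $$ (p, q))"
      using assms W_carrier[of x] by (cases "x \<in> I") auto
  qed
  have "integrable lebesgue (\<lambda>x. indicator I x *\<^sub>R ((of_real (x ^ k) \<cdot>\<^sub>m W x) $$ (p, q)))"
    using weight assms unfolding matrix_weight_def mat_integrable_def set_integrable_def by blast
  then show ?thesis
    using assms unfolding moment_def mat_integral_def set_lebesgue_integral_def
    by (simp add: has_bochner_integral_iff flip: eq)
qed

lemma moment_selfadjoint: "mat_adjoint (moment N a b W k) = moment N a b W k"
proof (rule eq_matI)
  fix i j assume "i < dim_row (moment N a b W k)" "j < dim_col (moment N a b W k)"
  then have ij: "i < N" "j < N" by (simp_all add: moment_def mat_integral_def)
  have sym: "cnj (W x $$ (j, i)) = W x $$ (i, j)" if "x \<in> I" for x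
  proof -
    have "mat_adjoint (W x) = W x"
      using weight that by (simp add: matrix_weight_def pos_semidef_def)
    then have "W x $$ (i, j) = mat_adjoint (W x) $$ (i, j)" by simp
    also have "\<dots> = cnj (W x $$ (j, i))" using W_carrier[OF that] ij by simp
    finally show ?thesis by simp
  qed
  have "(\<lambda>x. cnj (indicator I x *\<^sub>R (of_real x ^ k * W x $$ (j, i))))
      = (\<lambda>x. indicator I x *\<^sub>R (of_real x ^ k * W x $$ (i, j)))"
    by (rule ext) (simp add: sym split: split_indicator)
  then have "has_bochner_integral lebesgue (\<lambda>x. indicator I x *\<^sub>R (of_real x ^ k * W x $$ (i, j)))
      (cnj (moment N a b W k $$ (j, i)))"
    using has_bochner_integral_cnj[OF moment_has_integral[OF ij(2,1)], of k] by simp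
  then have "cnj (moment N a b W k $$ (j, i)) = moment N a b W k $$ (i, j)"
    by (rule has_bochner_integral_eq[OF _ moment_has_integral[OF ij]])
  then show "mat_adjoint (moment N a b W k) $$ (i, j) = moment N a b W k $$ (i, j)"
    using ij carrier_matD[OF moment_carrier[of N a b W k]] by simp
qed (simp_all add: moment_def mat_integral_def)

text \<open>Scalar form of the inner product: \<open>r\<close> and \<open>s\<close> are row vectors
  of polynomials, with \<open>c k p\<close> and \<open>d j q\<close> the coefficients of their
  components. As \<open>x\<close> is real, conjugating \<open>s\<close> affects only its
  coefficients, and the powers combine to \<open>x ^ (k + j)\<close>.\<close>

lemma pairing_has_integral:
  fixes c d :: "nat \<Rightarrow> nat \<Rightarrow> complex" and n m :: nat
  defines "r \<equiv> \<lambda>x p. \<Sum>k<n. c k p * of_real x ^ k" and "s \<equiv> \<lambda>x q. \<Sum>j<m. d j q * of_real x ^ j"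
  shows "has_bochner_integral lebesgue
    (\<lambda>x. indicator I x *\<^sub>R (\<Sum>q<N. (\<Sum>p<N. r x p * W x $$ (p, q)) * cnj (s x q)))
    (\<Sum>j<m. \<Sum>q<N. (\<Sum>k<n. \<Sum>p<N. c k p * moment N a b W (k + j) $$ (p, q)) * cnj (d j q))"
proof -
  have "has_bochner_integral lebesgue
    (\<lambda>x. \<Sum>j<m. \<Sum>q<N. (\<Sum>k<n. \<Sum>p<N. c k p *
        (indicator I x *\<^sub>R (of_real x ^ (k + j) * W x $$ (p, q)))) * cnj (d j q))
    (\<Sum>j<m. \<Sum>q<N. (\<Sum>k<n. \<Sum>p<N. c k p * moment N a b W (k + j) $$ (p, q)) * cnj (d j q))"
    by (intro has_bochner_integral_sum has_bochner_integral_mult_left has_bochner_integral_mult_right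
        moment_has_integral) auto
  moreover have "(\<Sum>j<m. \<Sum>q<N. (\<Sum>k<n. \<Sum>p<N. c k p *
        (indicator I x *\<^sub>R (of_real x ^ (k + j) * W x $$ (p, q)))) * cnj (d j q))
    = indicator I x *\<^sub>R (\<Sum>q<N. (\<Sum>p<N. r x p * W x $$ (p, q)) * cnj (s x q))" (is "?L = ?R") for x
  proof -
    have inner: "(\<Sum>k<n. \<Sum>p<N. c k p * (of_real x ^ (k + j) * W x $$ (p, q)))
        = (\<Sum>p<N. r x p * W x $$ (p, q)) * of_real x ^ j" for j q
      unfolding r_def sum_distrib_right by (subst sum.swap) (simp add: power_add mult_ac)
    have outer: "(\<Sum>j<m. A * of_real x ^ j * cnj (d j q)) = A * cnj (s x q)" for A q
      unfolding s_def by (simp add: sum_distrib_left mult_ac)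
    have "?L = indicator I x *\<^sub>R (\<Sum>j<m. \<Sum>q<N. (\<Sum>k<n. \<Sum>p<N. c k p *
        (of_real x ^ (k + j) * W x $$ (p, q))) * cnj (d j q))"
      by (simp add: indicator_def)
    also have "(\<Sum>j<m. \<Sum>q<N. (\<Sum>k<n. \<Sum>p<N. c k p *
        (of_real x ^ (k + j) * W x $$ (p, q))) * cnj (d j q))
      = (\<Sum>q<N. \<Sum>j<m. (\<Sum>p<N. r x p * W x $$ (p, q)) * of_real x ^ j * cnj (d j q))"
      unfolding inner by (rule sum.swap)
    also have "\<dots> = (\<Sum>q<N. (\<Sum>p<N. r x p * W x $$ (p, q)) * cnj (s x q))"
      unfolding outer ..
    finally show ?thesis .
  qed
  ultimately show ?thesis by simp
qed

text \<open>The integrand \<open>r W r^*\<close> is nonnegative with integral zero, so it vanishes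
  almost everywhere. Where \<open>W x\<close> is also positive definite this forces
  \<open>r x\<close> to vanish, and a polynomial vanishing almost everywhere on a nonempty open
  interval is zero.\<close>

lemma pairing_definite:
  fixes c :: "nat \<Rightarrow> nat \<Rightarrow> complex"
  assumes 0: "(\<Sum>j<n. \<Sum>q<N. (\<Sum>k<n. \<Sum>p<N. c k p * moment N a b W (k + j) $$ (p, q)) * cnj (c j q)) = 0"
    and kp: "k < n" "p < N"
  shows "c k p = 0"
proof -
  define r where "r = (\<lambda>x p. \<Sum>k<n. c k p * of_real x ^ k)"
  define f where "f x = indicator I x *\<^sub>R (\<Sum>q<N. (\<Sum>p<N. r x p * W x $$ (p, q)) * cnj (r x q))" for x :: real
  define v where "v x = vec N (\<lambda>p. cnj (r x p))" for x
  have int: "has_bochner_integral lebesgue f 0"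
    using pairing_has_integral[of c n c n] unfolding 0 f_def r_def .
  have f_form: "f x = (W x *\<^sub>v v x) \<bullet>c v x" if "x \<in> I" for x
    using that quadratic_form_vec[OF W_carrier[OF that], of "r x"] by (simp add: f_def v_def)
  have f_nonneg: "0 \<le> Re (f x)" for x
  proof (cases "x \<in> I")
    case True
    then have "0 \<le> (W x *\<^sub>v v x) \<bullet>c v x"
      using weight W_carrier[OF True] by (auto simp: matrix_weight_def pos_semidef_def v_def)
    then show ?thesis using f_form[OF True] by (simp add: less_eq_complex_def)
  qed (simp add: f_def)
  have "has_bochner_integral lebesgue (\<lambda>x. Re (f x)) 0"
    using has_bochner_integral_Re[OF int] by simp
  then have "AE x in lebesgue. Re (f x) = 0"
    using f_nonneg integral_nonneg_eq_0_iff_AE[of lebesgue "\<lambda>x. Re (f x)"]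
    by (simp add: has_bochner_integral_iff)
  moreover have "AE x in lebesgue. x \<in> I \<longrightarrow> pos_def (W x)"
    using weight by (simp add: matrix_weight_def)
  ultimately have rootAE: "AE x in lebesgue. x \<in> I \<longrightarrow> r x p = 0"
  proof eventually_elim
    case (elim x)
    show ?case
    proof
      assume x: "x \<in> I"
      have "v x = 0\<^sub>v N"
      proof (rule ccontr)
        assume "v x \<noteq> 0\<^sub>v N"
        then have "0 < (W x *\<^sub>v v x) \<bullet>c v x"
          using elim x W_carrier[OF x] by (auto simp: pos_def_def v_def)
        then show False using elim f_form[OF x] by (simp add: less_complex_def)
      qed
      then have "v x $ p = 0" using kp by simp
      then show "r x p = 0" using kp by (simp add: v_def)
    qed
  qed
  define R where "R = (\<Sum>k<n. monom (c k p) k)"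
  have R: "poly R (of_real x) = r x p" for x by (simp add: R_def r_def poly_sum poly_monom)
  have "R = 0"
  proof (rule ccontr)
    assume "R \<noteq> 0"
    \<comment> \<open>The real roots of \<open>R\<close> form a null set, yet almost every point of
      the interval is a root; the nonempty open interval would then be negligible.\<close>
    then have "finite {x. poly R x = 0}" by (rule poly_roots_finite)
    then have "finite (of_real -` {x. poly R x = 0} :: real set)"
      by (rule finite_vimageI) (simp add: inj_on_def)
    then have "(of_real -` {x. poly R x = 0} :: real set) \<in> null_sets lebesgue"
      by (intro null_sets_completionI finite_imp_null_set_lborel)
    from AE_not_in[OF this] rootAE have "AE x in lebesgue. x \<notin> I"
      by eventually_elim (auto simp: R)
    then have "negligible I" by (simp add: AE_iff_null_sets negligible_iff_null_sets)
    then show False using open_not_negligible[of I] einterval_nonempty[OF nonempty] by auto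
  qed
  then have "coeff R k = 0" by simp
  then show ?thesis using kp by (simp add: R_def coeff_sum)
qed

text \<open>Entry \<open>(i, l)\<close> pairs row \<open>i\<close> of the first polynomial with row
  \<open>l\<close> of the second, which reduces matrix statements to the scalar pairing.\<close>

lemma mat_sum_pairing_entry:
  assumes "\<And>k. C k \<in> carrier_mat N N" "\<And>k. D k \<in> carrier_mat N N" "\<And>k. M k \<in> carrier_mat N N" "i < N" "l < N"
  shows "mat_sum N (\<lambda>j. mat_sum N (\<lambda>k. C k * M (k + j)) {..<n} * mat_adjoint (D j)) {..<m} $$ (i, l)
    = (\<Sum>j<m. \<Sum>q<N. (\<Sum>k<n. \<Sum>p<N. C k $$ (i, p) * M (k + j) $$ (p, q)) * cnj (D j $$ (l, q)))"
proof -
  have "(mat_sum N (\<lambda>k. C k * M (k + j)) {..<n} * mat_adjoint (D j)) $$ (i, l)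
    = (\<Sum>q<N. (\<Sum>k<n. \<Sum>p<N. C k $$ (i, p) * M (k + j) $$ (p, q)) * cnj (D j $$ (l, q)))" for j
    unfolding mat_mult_entry[OF mat_sum_carrier mat_adjoint_carrier[OF assms(2)] assms(4,5)]
    using assms(2)[of j] assms(4,5)
    by (intro sum.cong refl) (simp add: mat_mult_entry[OF assms(1,3)] del: index_mult_mat(1))
  then show ?thesis using assms(4,5) by simp
qed

text \<open>A diagonal entry \<open>(i, i)\<close> of the product pairs row \<open>i\<close> with
  itself, so \<open>pairing_definite\<close> applies row by row.\<close>

lemma moments_definite:
  assumes D: "\<And>k. D k \<in> carrier_mat N N"
    and 0: "mat_sum N (\<lambda>j. mat_sum N (\<lambda>k. D k * moment N a b W (k + j)) {..<n} * mat_adjoint (D j)) {..<n} = 0\<^sub>m N N"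
    and l: "l < n"
  shows "D l = 0\<^sub>m N N"
proof (rule eq_matI)
  fix i p assume "i < dim_row (0\<^sub>m N N :: complex mat)" "p < dim_col (0\<^sub>m N N :: complex mat)"
  then have ip: "i < N" "p < N" by auto
  have "(\<Sum>j<n. \<Sum>q<N. (\<Sum>k<n. \<Sum>p<N. D k $$ (i, p) * moment N a b W (k + j) $$ (p, q)) * cnj (D j $$ (i, q)))
    = mat_sum N (\<lambda>j. mat_sum N (\<lambda>k. D k * moment N a b W (k + j)) {..<n} * mat_adjoint (D j)) {..<n} $$ (i, i)"
    by (rule mat_sum_pairing_entry[OF D D moment_carrier ip(1) ip(1), symmetric])
  also have "\<dots> = 0" unfolding 0 using ip by simp
  finally have "D l $$ (i, p) = 0" by (rule pairing_definite[OF _ l ip(2)])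
  then show "D l $$ (i, p) = 0\<^sub>m N N $$ (i, p)" using ip by simp
qed (use D in auto)

text \<open>The bridge from orthogonality under the integral to the double sums of
  \<open>monic_hankel_orthogonal\<close>; \<open>n\<close> and \<open>m\<close> are strict bounds
  for the exponents that occur.\<close>

lemma mat_integral_pairing:
  assumes F: "F \<in> carrier_mat N N" "\<And>k i j. n \<le> k \<Longrightarrow> i < N \<Longrightarrow> j < N \<Longrightarrow> coeff (F $$ (i, j)) k = 0"
    and G: "G \<in> carrier_mat N N" "\<And>k i j. m \<le> k \<Longrightarrow> i < N \<Longrightarrow> j < N \<Longrightarrow> coeff (G $$ (i, j)) k = 0"
  shows "mat_integral N a b
      (\<lambda>x. mat_poly_eval F (of_real x) * W x * mat_adjoint (mat_poly_eval G (of_real x)))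
    = mat_sum N (\<lambda>j. mat_sum N (\<lambda>k. mat_poly_coeff F k * moment N a b W (k + j)) {..<n}
        * mat_adjoint (mat_poly_coeff G j)) {..<m}"
proof (rule eq_matI)
  fix i l
  assume "i < dim_row (mat_sum N (\<lambda>j. mat_sum N (\<lambda>k. mat_poly_coeff F k * moment N a b W (k + j)) {..<n}
        * mat_adjoint (mat_poly_coeff G j)) {..<m})"
    and "l < dim_col (mat_sum N (\<lambda>j. mat_sum N (\<lambda>k. mat_poly_coeff F k * moment N a b W (k + j)) {..<n}
        * mat_adjoint (mat_poly_coeff G j)) {..<m})"
  then have il: "i < N" "l < N" by auto
  have coeffs: "mat_poly_coeff F k \<in> carrier_mat N N" "mat_poly_coeff G k \<in> carrier_mat N N" for k
    using F(1) G(1) by (auto simp: mat_poly_coeff_def)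
  have evals: "mat_poly_eval F x \<in> carrier_mat N N" "mat_poly_eval G x \<in> carrier_mat N N" for x
    using F(1) G(1) by (auto simp: mat_poly_eval_def)
  \<comment> \<open>Besides padding beyond the degree, this covers \<open>n = 0\<close>, where
    \<open>q\<close> is zero but \<open>degree q\<close> is still 0.\<close>
  have expand: "poly q x = (\<Sum>k<n. coeff q k * x ^ k)" if "\<And>k. n \<le> k \<Longrightarrow> coeff q k = 0"
    for q :: "complex poly" and x n
  proof -
    have "poly q x = (\<Sum>k\<le>degree q. coeff q k * x ^ k)" by (rule poly_altdef)
    also have "\<dots> = (\<Sum>k<n. coeff q k * x ^ k)"
    proof (rule sum.mono_neutral_cong)
      show "coeff q k * x ^ k = 0" if "k \<in> {..<n} - {..degree q}" for k
        using that by (simp add: coeff_eq_0)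
      show "coeff q k * x ^ k = 0" if "k \<in> {..degree q} - {..<n}" for k
        using that \<open>\<And>k. n \<le> k \<Longrightarrow> coeff q k = 0\<close> by simp
    qed auto
    finally show ?thesis .
  qed
  have "(LINT x:I|lebesgue. (mat_poly_eval F (of_real x) * W x * mat_adjoint (mat_poly_eval G (of_real x))) $$ (i, l))
    = (LINT x:I|lebesgue. \<Sum>q<N. (\<Sum>p<N. (\<Sum>k<n. coeff (F $$ (i, p)) k * of_real x ^ k) * W x $$ (p, q))
        * cnj (\<Sum>j<m. coeff (G $$ (l, q)) j * of_real x ^ j))"
  proof (intro set_lebesgue_integral_cong allI impI)
    fix x assume x: "x \<in> I"
    have FW: "mat_poly_eval F (of_real x) * W x \<in> carrier_mat N N"
      by (rule mult_carrier_mat[OF evals(1) W_carrier[OF x]])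
    show "(mat_poly_eval F (of_real x) * W x * mat_adjoint (mat_poly_eval G (of_real x))) $$ (i, l)
      = (\<Sum>q<N. (\<Sum>p<N. (\<Sum>k<n. coeff (F $$ (i, p)) k * of_real x ^ k) * W x $$ (p, q))
        * cnj (\<Sum>j<m. coeff (G $$ (l, q)) j * of_real x ^ j))"
      unfolding mat_mult_entry[OF FW mat_adjoint_carrier[OF evals(2)] il]
    proof (rule sum.cong[OF refl])
      fix q assume "q \<in> {..<N}"
      then have q: "q < N" by simp
      have "(mat_poly_eval F (of_real x) * W x) $$ (i, q)
        = (\<Sum>p<N. (\<Sum>k<n. coeff (F $$ (i, p)) k * of_real x ^ k) * W x $$ (p, q))"
        unfolding mat_mult_entry[OF evals(1) W_carrier[OF x] il(1) q]
      proof (rule sum.cong[OF refl])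
        fix p assume "p \<in> {..<N}"
        then show "mat_poly_eval F (of_real x) $$ (i, p) * W x $$ (p, q)
          = (\<Sum>k<n. coeff (F $$ (i, p)) k * of_real x ^ k) * W x $$ (p, q)"
          using F il by (simp add: mat_poly_eval_def expand[of n])
      qed
      moreover have "mat_adjoint (mat_poly_eval G (of_real x)) $$ (q, l)
        = cnj (\<Sum>j<m. coeff (G $$ (l, q)) j * of_real x ^ j)"
        using G il q by (simp add: mat_poly_eval_def expand[of m])
      ultimately show "(mat_poly_eval F (of_real x) * W x) $$ (i, q)
          * mat_adjoint (mat_poly_eval G (of_real x)) $$ (q, l)
        = (\<Sum>p<N. (\<Sum>k<n. coeff (F $$ (i, p)) k * of_real x ^ k) * W x $$ (p, q))
          * cnj (\<Sum>j<m. coeff (G $$ (l, q)) j * of_real x ^ j)" by simp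
    qed
  qed simp
  also have "\<dots> = (\<Sum>j<m. \<Sum>q<N. (\<Sum>k<n. \<Sum>p<N. coeff (F $$ (i, p)) k * moment N a b W (k + j) $$ (p, q))
      * cnj (coeff (G $$ (l, q)) j))"
    unfolding set_lebesgue_integral_def
    by (rule has_bochner_integral_integral_eq[OF pairing_has_integral])
  also have "\<dots> = (\<Sum>j<m. \<Sum>q<N. (\<Sum>k<n. \<Sum>p<N. mat_poly_coeff F k $$ (i, p) * moment N a b W (k + j) $$ (p, q))
      * cnj (mat_poly_coeff G j $$ (l, q)))"
    using F(1) G(1) il by (simp add: mat_poly_coeff_def)
  also have "\<dots> = mat_sum N (\<lambda>j. mat_sum N (\<lambda>k. mat_poly_coeff F k * moment N a b W (k + j)) {..<n}
        * mat_adjoint (mat_poly_coeff G j)) {..<m} $$ (i, l)"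
    by (rule mat_sum_pairing_entry[OF coeffs moment_carrier il, symmetric])
  finally show "mat_integral N a b
      (\<lambda>x. mat_poly_eval F (of_real x) * W x * mat_adjoint (mat_poly_eval G (of_real x))) $$ (i, l)
    = mat_sum N (\<lambda>j. mat_sum N (\<lambda>k. mat_poly_coeff F k * moment N a b W (k + j)) {..<n}
        * mat_adjoint (mat_poly_coeff G j)) {..<m} $$ (i, l)"
    using il by (simp add: mat_integral_def)
qed (simp_all add: mat_integral_def)

lemma monic_orthogonal_imp_hankel:
  assumes "monic_orthogonal_polynomials N a b W P"
  shows "monic_hankel_orthogonal N (moment N a b W) (\<lambda>n. mat_poly_coeff (P n))"
proof
  have monic: "monic_of_degree N n (P n)" for n
    using assms by (simp add: monic_orthogonal_polynomials_def)
  then have P: "P n \<in> carrier_mat N N" for n by (simp add: monic_of_degree_def)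
  show "mat_poly_coeff (P n) k \<in> carrier_mat N N" for n k
    using P[of n] by (simp add: mat_poly_coeff_def)
  show "mat_poly_coeff (P n) n = 1\<^sub>m N" for n using monic[of n] by (simp add: monic_of_degree_def)
  show deg: "mat_poly_coeff (P n) k = 0\<^sub>m N N" if "n < k" for n k
    using monic[of n] that by (simp add: monic_of_degree_def)
  have coeff0: "coeff (P n $$ (i, j)) k = 0" if "Suc n \<le> k" "i < N" "j < N" for n k i j
    using arg_cong[OF deg[of n k], of "\<lambda>X. X $$ (i, j)"] that P[of n]
    by (simp add: mat_poly_coeff_def)
  show "mat_sum N (\<lambda>j. mat_sum N (\<lambda>k. mat_poly_coeff (P n) k * moment N a b W (k + j)) {..<Suc n}
      * mat_adjoint (mat_poly_coeff (P m) j)) {..<Suc m} = 0\<^sub>m N N" if "n \<noteq> m" for n m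
    using assms that mat_integral_pairing[OF P[of n] coeff0[of n] P[of m] coeff0[of m]]
    by (simp add: monic_orthogonal_polynomials_def)
qed (fact moment_carrier moment_selfadjoint moments_definite)+

end

section \<open>Commutation with matrix polynomials and block diagonalization\<close>

text \<open>\<open>L i j\<close> and \<open>R i j\<close> are the polynomial entries of T P and P T.
  Complex polynomials with equal values everywhere have equal coefficients, so the commutant can be
  studied through coefficients.\<close>

lemma commute_eval_iff_commute_coeff:
  assumes T: "T \<in> carrier_mat N N" and P: "P \<in> carrier_mat N N"
  shows "(\<forall>x. T * mat_poly_eval P x = mat_poly_eval P x * T) \<longleftrightarrow>
    (\<forall>k. T * mat_poly_coeff P k = mat_poly_coeff P k * T)"
proof -
  define L where "L i j = (\<Sum>l<N. Polynomial.smult (T $$ (i, l)) (P $$ (l, j)))" for i j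
  define R where "R i j = (\<Sum>l<N. Polynomial.smult (T $$ (l, j)) (P $$ (i, l)))" for i j
  have ev: "mat_poly_eval P x \<in> carrier_mat N N" "mat_poly_coeff P k \<in> carrier_mat N N" for x k
    using P by (auto simp: mat_poly_eval_def mat_poly_coeff_def)
  have entries: "mat_poly_eval P x $$ (i, j) = poly (P $$ (i, j)) x"
      "mat_poly_coeff P k $$ (i, j) = coeff (P $$ (i, j)) k" if "i < N" "j < N" for x k i j
    using P that by (auto simp: mat_poly_eval_def mat_poly_coeff_def)
  have prods: "T * mat_poly_eval P x = mat N N (\<lambda>(i, j). poly (L i j) x)"
    "mat_poly_eval P x * T = mat N N (\<lambda>(i, j). poly (R i j) x)"
    "T * mat_poly_coeff P k = mat N N (\<lambda>(i, j). coeff (L i j) k)"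
    "mat_poly_coeff P k * T = mat N N (\<lambda>(i, j). coeff (R i j) k)" for x k
    using T carrier_matD[OF ev(1)] carrier_matD[OF ev(2)]
    by (auto intro!: eq_matI sum.cong simp: mat_mult_entry[OF T ev(1)] mat_mult_entry[OF T ev(2)]
        mat_mult_entry[OF ev(1) T] mat_mult_entry[OF ev(2) T] L_def R_def poly_sum coeff_sum
        entries simp del: index_mult_mat(1))
  have mat_eq: "mat N N (\<lambda>(i, j). f i j) = mat N N (\<lambda>(i, j). g i j) \<longleftrightarrow> (\<forall>i<N. \<forall>j<N. f i j = g i j)"
    for f g :: "nat \<Rightarrow> nat \<Rightarrow> complex"
  proof
    assume eq: "mat N N (\<lambda>(i, j). f i j) = mat N N (\<lambda>(i, j). g i j)"
    show "\<forall>i<N. \<forall>j<N. f i j = g i j"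
    proof (intro allI impI)
      fix i j assume "i < N" "j < N"
      then show "f i j = g i j" using arg_cong[OF eq, of "\<lambda>X. X $$ (i, j)"] by simp
    qed
  qed (auto intro!: eq_matI)
  have "(\<forall>x. T * mat_poly_eval P x = mat_poly_eval P x * T) \<longleftrightarrow>
      (\<forall>i<N. \<forall>j<N. poly (L i j) = poly (R i j))"
    unfolding prods mat_eq fun_eq_iff by blast
  also have "\<dots> \<longleftrightarrow> (\<forall>i<N. \<forall>j<N. \<forall>k. coeff (L i j) k = coeff (R i j) k)"
    unfolding poly_eq_poly_eq_iff poly_eq_iff ..
  also have "\<dots> \<longleftrightarrow> (\<forall>k. T * mat_poly_coeff P k = mat_poly_coeff P k * T)"
    unfolding prods mat_eq by blast
  finally show ?thesis .
qed

text \<open>Comparing entries \<open>(i, j)\<close> of the two products gives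
  \<open>J $$ (i, i) * X $$ (i, j) = X $$ (i, j) * J $$ (j, j)\<close>.\<close>

lemma diagonal_commute_entry_zero:
  fixes X J :: "complex mat"
  assumes X: "X \<in> carrier_mat N N" and J: "J \<in> carrier_mat N N"
    and diag: "\<And>i j. i < N \<Longrightarrow> j < N \<Longrightarrow> i \<noteq> j \<Longrightarrow> J $$ (i, j) = 0"
    and comm: "J * X = X * J" and ij: "i < N" "j < N" "J $$ (i, i) \<noteq> J $$ (j, j)"
  shows "X $$ (i, j) = 0"
proof -
  have "(J * X) $$ (i, j) = (\<Sum>l\<in>{i}. J $$ (i, l) * X $$ (l, j))"
    unfolding mat_mult_entry[OF J X ij(1,2)] using ij diag by (intro sum.mono_neutral_right) auto
  moreover have "(X * J) $$ (i, j) = (\<Sum>l\<in>{j}. X $$ (i, l) * J $$ (l, j))"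
    unfolding mat_mult_entry[OF X J ij(1,2)] using ij diag by (intro sum.mono_neutral_right) auto
  ultimately show ?thesis using comm ij(3) by (simp add: mult.commute)
qed

lemma reducible_of_commuting_diagonal:
  assumes P: "\<And>n. P n \<in> carrier_mat N N"
    and Q: "Q \<in> carrier_mat N N" and R: "R \<in> carrier_mat N N" and inv: "Q * R = 1\<^sub>m N"
    and J: "J \<in> carrier_mat N N" "\<And>i j. i < N \<Longrightarrow> j < N \<Longrightarrow> i \<noteq> j \<Longrightarrow> J $$ (i, j) = 0"
    and J_distinct: "r < N" "s < N" "J $$ (r, r) \<noteq> J $$ (s, s)"
    and comm: "\<And>n x. J * (Q * mat_poly_eval (P n) x * R) = Q * mat_poly_eval (P n) x * R * J"
  shows "reducible_seq N P"
proof -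
  \<comment> \<open>\<open>E\<close> selects the indices sharing the eigenvalue at \<open>r\<close>.
    The index \<open>r\<close> satisfies it and \<open>s\<close> does not, so both blocks are
    nonempty; \<open>xs\<close> is the permutation listing the first group before the
    second.\<close>
  define E where "E i \<longleftrightarrow> J $$ (i, i) = J $$ (r, r)" for i
  define xs where "xs = filter E [0..<N] @ filter (\<lambda>i. \<not> E i) [0..<N]"
  define N1 where "N1 = length (filter E [0..<N])"
  define N2 where "N2 = length (filter (\<lambda>i. \<not> E i) [0..<N])"
  have N12: "N1 + N2 = N" unfolding N1_def N2_def by (simp add: sum_length_filter_compl)
  have len: "length xs = N" using N12 by (simp add: xs_def N1_def N2_def)
  have dist: "distinct xs" by (auto simp: xs_def)
  have set_xs: "set xs = {..<N}" by (auto simp: xs_def)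
  have "r \<in> set (filter E [0..<N])" "s \<in> set (filter (\<lambda>i. \<not> E i) [0..<N])"
    using J_distinct by (auto simp: E_def)
  then have pos: "0 < N1" "0 < N2" unfolding N1_def N2_def by (metis length_pos_if_in_set)+
  have xs_less: "xs ! i < N" if "i < N" for i
    using that set_xs len nth_mem[of i xs] by auto
  have xs_low: "E (xs ! i)" if "i < N1" for i
    using that nth_mem[of i "filter E [0..<N]"] by (simp add: xs_def nth_append N1_def)
  have xs_high: "\<not> E (xs ! i)" if "N1 \<le> i" "i < N" for i
    using that N12 nth_mem[of "i - N1" "filter (\<lambda>i. \<not> E i) [0..<N]"]
    by (simp add: xs_def nth_append N1_def N2_def)
  \<comment> \<open>Permuting the rows of \<open>Q\<close> and the columns of \<open>R\<close> by
    \<open>xs\<close> makes each eigenvalue group contiguous.\<close>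
  define M where "M = mat N N (\<lambda>(i, j). Q $$ (xs ! i, j))"
  define M' where "M' = mat N N (\<lambda>(i, j). R $$ (i, xs ! j))"
  have M: "M \<in> carrier_mat N N" "M' \<in> carrier_mat N N" by (simp_all add: M_def M'_def)
  have conj_entry: "(M * X * M') $$ (i, j) = (Q * X * R) $$ (xs ! i, xs ! j)"
    if X: "X \<in> carrier_mat N N" and ij: "i < N" "j < N" for X i j
  proof -
    note MX = mult_carrier_mat[OF M(1) X] and QX = mult_carrier_mat[OF Q X]
    show ?thesis
      unfolding mat_mult_entry[OF MX M(2) ij] mat_mult_entry[OF QX R xs_less[OF ij(1)] xs_less[OF ij(2)]]
    proof (rule sum.cong[OF refl])
      fix l assume "l \<in> {..<N}"
      then have l: "l < N" by simp
      show "(M * X) $$ (i, l) * M' $$ (l, j) = (Q * X) $$ (xs ! i, l) * R $$ (l, xs ! j)"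
        unfolding mat_mult_entry[OF M(1) X ij(1) l] mat_mult_entry[OF Q X xs_less[OF ij(1)] l]
        using ij l by (simp add: M_def M'_def)
    qed
  qed
  have MM': "M * M' = 1\<^sub>m N"
  proof (rule eq_matI)
    fix i j assume "i < dim_row (1\<^sub>m N :: complex mat)" "j < dim_col (1\<^sub>m N :: complex mat)"
    then have ij: "i < N" "j < N" by auto
    \<comment> \<open>Conjugation of the identity, whose entries are unchanged by the permutation
      because \<open>xs\<close> is distinct.\<close>
    have "(M * M') $$ (i, j) = (1\<^sub>m N :: complex mat) $$ (xs ! i, xs ! j)"
      using conj_entry[OF one_carrier_mat ij] M(1) Q inv by simp
    also have "\<dots> = (1\<^sub>m N :: complex mat) $$ (i, j)"
      using ij xs_less nth_eq_iff_index_eq[OF dist] len by simp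
    finally show "(M * M') $$ (i, j) = (1\<^sub>m N :: complex mat) $$ (i, j)" .
  qed (use M in auto)
  have M'M: "M' * M = 1\<^sub>m N" using mat_mult_left_right_inverse[OF M MM'] .
  \<comment> \<open>The blocks must be matrices of polynomials, not just block matrices at each
    point; \<open>Y n i j\<close> is the polynomial whose values are entry \<open>(i, j)\<close> of
    the conjugated P_n.\<close>
  define Y where "Y n i j = (\<Sum>l<N. \<Sum>m<N. Polynomial.smult (M $$ (i, m) * M' $$ (l, j)) (P n $$ (m, l)))" for n i j
  have ev: "mat_poly_eval (P n) x \<in> carrier_mat N N" for n x
    using P[of n] by (simp add: mat_poly_eval_def)
  have Y: "poly (Y n i j) x = (M * mat_poly_eval (P n) x * M') $$ (i, j)" if ij: "i < N" "j < N" for n i j x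
  proof -
    have "(M * mat_poly_eval (P n) x * M') $$ (i, j)
      = (\<Sum>l<N. (M * mat_poly_eval (P n) x) $$ (i, l) * M' $$ (l, j))"
      by (rule mat_mult_entry[OF mult_carrier_mat[OF M(1) ev] M(2) ij])
    also have "\<dots> = (\<Sum>l<N. \<Sum>m<N. M $$ (i, m) * M' $$ (l, j) * poly (P n $$ (m, l)) x)"
    proof (rule sum.cong[OF refl])
      fix l assume "l \<in> {..<N}"
      then have l: "l < N" by simp
      show "(M * mat_poly_eval (P n) x) $$ (i, l) * M' $$ (l, j)
        = (\<Sum>m<N. M $$ (i, m) * M' $$ (l, j) * poly (P n $$ (m, l)) x)"
        unfolding mat_mult_entry[OF M(1) ev ij(1) l] sum_distrib_right
        using P[of n] l by (intro sum.cong refl) (simp add: mat_poly_eval_def)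
    qed
    finally show ?thesis by (simp add: Y_def poly_sum)
  qed
  have zero: "(M * mat_poly_eval (P n) x * M') $$ (i, j) = 0"
    if "i < N" "j < N" "E (xs ! i) \<noteq> E (xs ! j)" for n x i j
  proof -
    have "Q * mat_poly_eval (P n) x * R \<in> carrier_mat N N"
      using Q R ev by (auto intro!: mult_carrier_mat[where n = N])
    from diagonal_commute_entry_zero[OF this J comm xs_less[OF that(1)] xs_less[OF that(2)]]
    show ?thesis using that conj_entry[OF ev that(1,2)] by (auto simp: E_def)
  qed
  define Q1 where "Q1 n = mat N1 N1 (\<lambda>(i, j). Y n i j)" for n
  define Q2 where "Q2 n = mat N2 N2 (\<lambda>(i, j). Y n (N1 + i) (N1 + j))" for n
  have block: "M * mat_poly_eval (P n) x * M' = four_block_mat (mat_poly_eval (Q1 n) x) (0\<^sub>m N1 N2)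
      (0\<^sub>m N2 N1) (mat_poly_eval (Q2 n) x)" (is "?L = ?B") for n x
  proof (rule eq_matI)
    have dims: "dim_row ?B = N" "dim_col ?B = N"
      using N12 by (simp_all add: mat_poly_eval_def Q1_def Q2_def)
    show "dim_row ?L = dim_row ?B" "dim_col ?L = dim_col ?B"
      unfolding dims using M by simp_all
    fix i j assume "i < dim_row ?B" "j < dim_col ?B"
    then have ij: "i < N" "j < N" unfolding dims .
    have B: "?B $$ (i, j) = (if i < N1 then if j < N1 then poly (Y n i j) x else 0
        else if j < N1 then 0 else poly (Y n i j) x)"
    proof -
      have "i - N1 < N2" if "\<not> i < N1" using that ij N12 by linarith
      moreover have "j - N1 < N2" if "\<not> j < N1" using that ij N12 by linarith
      ultimately show ?thesis using ij N12 by (simp add: mat_poly_eval_def Q1_def Q2_def)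
    qed
    show "?L $$ (i, j) = ?B $$ (i, j)"
      unfolding B Y[OF ij]
      using zero[OF ij] xs_low[of i] xs_low[of j] xs_high[of i] xs_high[of j] ij
      by (cases "i < N1"; cases "j < N1") (simp_all del: index_mult_mat(1))
  qed
  show ?thesis
    unfolding reducible_seq_def
  proof (intro exI conjI allI)
    show "M \<in> carrier_mat N N" "M' \<in> carrier_mat N N" by fact+
    show "inverts_mat M M'" "inverts_mat M' M" using MM' M'M M by (auto simp: inverts_mat_def)
    show "0 < N1" "0 < N2" "N1 + N2 = N" by fact+
    show "Q1 n \<in> carrier_mat N1 N1" "Q2 n \<in> carrier_mat N2 N2" for n by (simp_all add: Q1_def Q2_def)
    show "M * mat_poly_eval (P n) x * M' = four_block_mat (mat_poly_eval (Q1 n) x) (0\<^sub>m N1 N2)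
      (0\<^sub>m N2 N1) (mat_poly_eval (Q2 n) x)" for n x by (rule block)
  qed
qed

section \<open>From a reduction to a nonscalar commuting matrix\<close>

lemma reducible_imp_nonscalar_commutant:
  assumes P: "\<And>n. P n \<in> carrier_mat N N" and red: "reducible_seq N P"
  shows "\<exists>T \<in> commutant N P. \<not> scalar_mat N T"
proof -
  obtain M M' N1 N2 Q1 Q2 where M: "M \<in> carrier_mat N N" "M' \<in> carrier_mat N N"
    and inv: "inverts_mat M M'" "inverts_mat M' M" and N12: "0 < N1" "0 < N2" "N1 + N2 = N"
    and Q: "\<And>n. Q1 n \<in> carrier_mat N1 N1" "\<And>n. Q2 n \<in> carrier_mat N2 N2"
    and block: "\<And>n x. M * mat_poly_eval (P n) x * M' =
      four_block_mat (mat_poly_eval (Q1 n) x) (0\<^sub>m N1 N2) (0\<^sub>m N2 N1) (mat_poly_eval (Q2 n) x)"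
    using red unfolding reducible_seq_def by blast
  have MM': "M * M' = 1\<^sub>m N" "M' * M = 1\<^sub>m N" using inv M by (auto simp: inverts_mat_def)
  \<comment> \<open>The projection onto the first block commutes with all block diagonal matrices;
    conjugated back, it becomes the required \<open>T\<close>.\<close>
  define E :: "complex mat" where
    "E = four_block_mat (1\<^sub>m N1) (0\<^sub>m N1 N2) (0\<^sub>m N2 N1) (0\<^sub>m N2 N2)"
  have E: "E \<in> carrier_mat N N" using N12 by (auto simp: E_def)
  have ev: "mat_poly_eval (P n) x \<in> carrier_mat N N" for n x
    using P[of n] by (simp add: mat_poly_eval_def)
  note assoc = assoc_mult_mat[of _ N N _ N _ N]
  have EB: "E * (M * mat_poly_eval (P n) x * M') = M * mat_poly_eval (P n) x * M' * E" for n x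
  proof -
    have q: "mat_poly_eval (Q1 n) x \<in> carrier_mat N1 N1" "mat_poly_eval (Q2 n) x \<in> carrier_mat N2 N2"
      using Q[of n] by (simp_all add: mat_poly_eval_def)
    show ?thesis
      unfolding block E_def using q
      by (simp add: mult_four_block_mat[of _ N1 N1 _ N2 _ N2 _ _ N1 _ N2])
  qed
  define T where "T = M' * (E * M)"
  have EM: "E * M \<in> carrier_mat N N" by (rule mult_carrier_mat[OF E M(1)])
  have T: "T \<in> carrier_mat N N" unfolding T_def by (rule mult_carrier_mat[OF M(2) EM])
  have "T * mat_poly_eval (P n) x = mat_poly_eval (P n) x * T" for n x
  proof -
    let ?A = "mat_poly_eval (P n) x"
    have cars: "M * ?A \<in> carrier_mat N N" "M' * (M * ?A) \<in> carrier_mat N N" "M * ?A * M' \<in> carrier_mat N N"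
      using M ev[of n x] by (auto intro!: mult_carrier_mat[where n = N])
    \<comment> \<open>Inserting \<open>M' * M\<close> produces the conjugate
      \<open>M * ?A * M'\<close>, which \<open>EB\<close> moves past \<open>E\<close>.\<close>
    have "T * ?A = M' * (E * (M * ?A * (M' * M)))"
      unfolding T_def MM' using M E ev[of n x] cars by (simp add: assoc)
    also have "\<dots> = M' * (E * (M * ?A * M') * M)"
      using M E ev[of n x] cars by (simp add: assoc)
    also have "\<dots> = (M' * M) * ?A * (M' * (E * M))"
      unfolding EB using M E EM ev[of n x] cars by (simp add: assoc)
    also have "\<dots> = ?A * T"
      unfolding MM' T_def using ev[of n x] by simp
    finally show ?thesis .
  qed
  then have "T \<in> commutant N P" using T by (simp add: commutant_def)
  moreover have "\<not> scalar_mat N T"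
  proof
    assume "scalar_mat N T"
    then obtain c where c: "T = c \<cdot>\<^sub>m 1\<^sub>m N" by (auto simp: scalar_mat_def)
    have "M * T * M' = (M * M') * E * (M * M')"
      unfolding T_def using M E EM by (simp add: assoc)
    then have "E = M * T * M'" using MM' E by simp
    also have "\<dots> = c \<cdot>\<^sub>m 1\<^sub>m N"
      unfolding c using M MM' by (simp add: mult_smult_distrib[of _ N N _ N] mult_smult_assoc_mat[of _ N N _ N])
    finally have E_eq: "E = c \<cdot>\<^sub>m 1\<^sub>m N" .
    \<comment> \<open>Both blocks have positive size, so the projection has a diagonal entry 1 and a
      diagonal entry 0.\<close>
    have "E $$ (0, 0) = 1" "E $$ (N1, N1) = 0" using N12 by (simp_all add: E_def)
    then show False unfolding E_eq using N12 by simp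
  qed
  ultimately show ?thesis by blast
qed

section \<open>From a nonscalar commuting matrix to a reduction\<close>

lemma scalar_mat_add: "scalar_mat N A \<Longrightarrow> scalar_mat N B \<Longrightarrow> scalar_mat N (A + B)"
  unfolding scalar_mat_def by (metis add_smult_distrib_right_mat one_carrier_mat)

lemma scalar_mat_smult: "scalar_mat N A \<Longrightarrow> scalar_mat N (c \<cdot>\<^sub>m A)"
  unfolding scalar_mat_def by (auto intro!: eq_matI)

lemma nonscalar_commutant_imp_reducible:
  assumes hankel: "monic_hankel_orthogonal N M (\<lambda>n. mat_poly_coeff (P n))"
    and P: "\<And>n. P n \<in> carrier_mat N N"
    and T: "T \<in> commutant N P" "\<not> scalar_mat N T"
  shows "reducible_seq N P"
proof -
  interpret monic_hankel_orthogonal N M "\<lambda>n. mat_poly_coeff (P n)" by (rule hankel)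
  have Tc: "T \<in> carrier_mat N N" using T(1) by (simp add: commutant_def)
  have Tp: "T * mat_poly_coeff (P n) k = mat_poly_coeff (P n) k * T" for n k
    using T(1) commute_eval_iff_commute_coeff[OF Tc P[of n]] by (simp add: commutant_def)
  obtain U where U: "U \<in> carrier_mat N N" "\<And>n k. U * mat_poly_coeff (P n) k = mat_poly_coeff (P n) k * U"
    "U * M 0 = M 0 * mat_adjoint T" "T * M 0 = M 0 * mat_adjoint U"
    using commuting_adjoint[OF Tc Tp] by blast
  note assoc = assoc_mult_mat[of _ N N _ N _ N]
    and distribs = mult_smult_distrib[of _ N N _ N] mult_smult_assoc_mat[of _ N N _ N]
      add_mult_distrib_mat[of _ N N _ _ N] mult_add_distrib_mat[of _ N N _ N]
  \<comment> \<open>Selfadjoint for \<open>M 0\<close> for every \<open>c\<close>, because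
    \<open>U\<close> is the adjoint of \<open>T\<close>. The values \<open>c = 1\<close> and
    \<open>c = \<i>\<close> play the part of real and imaginary parts of \<open>T\<close>.\<close>
  define H where "H c = c \<cdot>\<^sub>m T + cnj c \<cdot>\<^sub>m U" for c
  have H: "H c \<in> carrier_mat N N" for c using Tc U(1) by (simp add: H_def)
  have Hp: "H c * mat_poly_coeff (P n) k = mat_poly_coeff (P n) k * H c" for c n k
    unfolding H_def using Tc U(1) p_carrier[of n k] by (simp add: distribs Tp U(2))
  have self: "H c * M 0 = M 0 * mat_adjoint (H c)" for c
  proof -
    have aT: "mat_adjoint T \<in> carrier_mat N N" "mat_adjoint U \<in> carrier_mat N N" using Tc U(1) by simp_all
    have "mat_adjoint (H c) = cnj c \<cdot>\<^sub>m mat_adjoint T + c \<cdot>\<^sub>m mat_adjoint U"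
      unfolding H_def using Tc U(1) by (simp add: mat_adjoint_add[of _ N N] mat_adjoint_smult[of _ N N])
    then have "M 0 * mat_adjoint (H c) = cnj c \<cdot>\<^sub>m (U * M 0) + c \<cdot>\<^sub>m (T * M 0)"
      using aT by (simp add: distribs U(3,4))
    also have "\<dots> = c \<cdot>\<^sub>m (T * M 0) + cnj c \<cdot>\<^sub>m (U * M 0)"
      using Tc U(1) by (intro comm_add_mat[of _ N N]) (auto intro!: mult_carrier_mat[where n = N])
    also have "\<dots> = H c * M 0" unfolding H_def using Tc U(1) by (simp add: distribs)
    finally show ?thesis by simp
  qed
  \<comment> \<open>\<open>T\<close> is a combination of the two selfadjoint matrices, so they
    cannot both be scalar.\<close>
  have "T = (1/2) \<cdot>\<^sub>m H 1 + (- \<i> / 2) \<cdot>\<^sub>m H \<i>"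
    using Tc U(1) by (intro eq_matI) (auto simp: H_def field_simps)
  then obtain c where c: "\<not> scalar_mat N (H c)"
    using T(2) scalar_mat_add scalar_mat_smult by metis
  obtain Q R J where QRJ: "Q \<in> carrier_mat N N" "R \<in> carrier_mat N N" "J \<in> carrier_mat N N"
    "Q * R = 1\<^sub>m N" "R * Q = 1\<^sub>m N" "Q * H c = J * Q"
    and diag: "\<And>i j. i < N \<Longrightarrow> j < N \<Longrightarrow> i \<noteq> j \<Longrightarrow> J $$ (i, j) = 0"
    using selfadjoint_diagonalizable[OF definite_M0 H self, of c] by blast
  \<comment> \<open>With a single eigenvalue, \<open>J\<close> would be scalar, and so would
    \<open>H c = R * J * Q\<close>.\<close>
  have "\<exists>r<N. \<exists>s<N. J $$ (r, r) \<noteq> J $$ (s, s)"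
  proof (rule ccontr)
    assume "\<not> ?thesis"
    then have const: "J $$ (i, i) = J $$ (0, 0)" if "i < N" for i
      using that by (metis gr_zeroI not_less_zero)
    define d where "d = J $$ (0, 0)"
    have d: "J = d \<cdot>\<^sub>m 1\<^sub>m N"
    proof (rule eq_matI)
      fix i j assume "i < dim_row (d \<cdot>\<^sub>m 1\<^sub>m N)" "j < dim_col (d \<cdot>\<^sub>m 1\<^sub>m N)"
      then have ij: "i < N" "j < N" by auto
      show "J $$ (i, j) = (d \<cdot>\<^sub>m 1\<^sub>m N) $$ (i, j)"
        using ij const[OF ij(1)] diag[OF ij] by (cases "i = j") (simp_all add: d_def)
    qed (use QRJ(3) in auto)
    have "H c = (R * Q) * H c" using left_mult_one_mat[OF H] QRJ(5) by simp
    also have "\<dots> = R * (J * Q)"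
      unfolding QRJ(6)[symmetric] using QRJ(1,2) H[of c] by (simp add: assoc)
    also have "\<dots> = d \<cdot>\<^sub>m (R * Q)" unfolding d using QRJ(1,2) by (simp add: distribs)
    finally show False using c QRJ(5) by (auto simp: scalar_mat_def)
  qed
  then obtain r s where rs: "r < N" "s < N" "J $$ (r, r) \<noteq> J $$ (s, s)" by blast
  have comm_J: "J * (Q * mat_poly_eval (P n) x * R) = Q * mat_poly_eval (P n) x * R * J" for n x
  proof -
    let ?A = "mat_poly_eval (P n) x"
    have A: "?A \<in> carrier_mat N N" using P[of n] by (simp add: mat_poly_eval_def)
    have comm: "H c * ?A = ?A * H c"
      using Hp[of c n] commute_eval_iff_commute_coeff[OF H P[of n]] by blast
    \<comment> \<open>The relation \<open>Q * H c = J * Q\<close> read for the columns of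
      \<open>R\<close>, which are right eigenvectors of \<open>H c\<close>.\<close>
    have HR: "H c * R = R * J"
    proof -
      have "H c * R = (R * Q) * H c * R" using left_mult_one_mat[OF H] QRJ(5) by simp
      also have "\<dots> = R * ((Q * H c) * R)" using H QRJ(1,2) by (simp add: assoc)
      also have "\<dots> = R * J * (Q * R)" unfolding QRJ(6) using QRJ(1-3) by (simp add: assoc)
      finally show ?thesis using QRJ by simp
    qed
    have "J * (Q * ?A * R) = (J * Q) * ?A * R" using QRJ(1-3) A by (simp add: assoc)
    also have "\<dots> = Q * (H c * ?A) * R" unfolding QRJ(6)[symmetric] using QRJ(1-3) A H[of c] by (simp add: assoc)
    also have "\<dots> = Q * ?A * (H c * R)" unfolding comm using QRJ(1-3) A H[of c] by (simp add: assoc)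
    also have "\<dots> = Q * ?A * R * J" unfolding HR using QRJ(1-3) A by (simp add: assoc)
    finally show ?thesis .
  qed
  show ?thesis
    by (rule reducible_of_commuting_diagonal[of P N Q R J, OF P QRJ(1,2,4,3) diag rs comm_J])
qed

theorem theorem4p9:
  fixes N :: nat and a b :: ereal
    and W :: "real \<Rightarrow> complex mat" and P :: "nat \<Rightarrow> complex poly mat"
  assumes "N \<ge> 1" and "a < b"
    and "matrix_weight N a b W"
    and "monic_orthogonal_polynomials N a b W P"
  shows "reducible_seq N P \<longleftrightarrow> (\<exists>T \<in> commutant N P. \<not> scalar_mat N T)"
proof -
  interpret positive_matrix_weight N a b W using assms(2,3) by unfold_locales
  have P: "P n \<in> carrier_mat N N" for n
    using assms(4) by (simp add: monic_orthogonal_polynomials_def monic_of_degree_def)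
  show ?thesis
    using reducible_imp_nonscalar_commutant[of P N, OF P]
      nonscalar_commutant_imp_reducible[OF monic_orthogonal_imp_hankel[OF assms(4)] P] by blast
qed

end
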